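(* Let $G$ be an infinite finitely generated group and let $G_{\circledast}$ be its pocket extension. Then for $p=1$ and for $p=2$, $$\Lambda_{p,G_{\circledast}}(v)\simeq \Lambda_{p,G}\left(\frac{\log(1+v)}{\log(1+\log(1+v))}\right),\quad v>0,$$ that is, there are constants $c_1,c_2,c_3,c_4\in(0,\infty)$ such that for all $v>0$, $$c_1\,\Lambda_{p,G}\left(c_2\frac{\log(1+v)}{\log(1+\log(1+v))}\right)\le \Lambda_{p,G_{\circledast}}(v)\le c_3\,\Lambda_{p,G}\left(c_4\frac{\log(1+v)}{\log(1+\log(1+v))}\right).$$
   Context: Pocket extension: let $G\cup\{*\}$ be the set $G$ with one extra point $*$ added. $G_{\circledast}$ is the subgroup of the full symmetric group $\mathbb S(G\cup\{*\})$ generated by all left translations $g\mapsto hg$, $h\in G$ (extended to fix $*$) and by the transposition $\tau=( *,\mathrm{id}_G)$. It is finitely generated. Profiles: for a symmetric probability measure $\phi$ on a group $H$ and $v>0$, and $p\in\{1,2\}$, $$\Lambda_{p,H,\phi}(v)=\inf\Big\{\tfrac12\sum_{x,y\in H}|f(yx)-f(x)|^p\phi(y):\ f:H\to\mathbb R,\ |\mathrm{support}(f)|\le v,\ \|f\|_p=1\Big\},$$ which is $+\infty$ for $v<1$. For a finitely generated group $H$, $\Lambda_{p,H}$ denotes $\Lambda_{p,H,\phi}$ for a fixed (arbitrary) symmetric finitely supported probability measure $\phi$ whose support generates $H$; changing $\phi$ changes $\Lambda_{p,H}$ only up to multiplicative constants. The constants $c_i$ may depend on $G$, $p$ and the chosen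 measures. *)

theory Defs
  imports "HOL-Algebra.Bij" "HOL-Algebra.Generated_Groups"
    "HOL-Probability.Probability_Mass_Function"
begin

definition finitely_generated :: "('a, 'b) monoid_scheme \<Rightarrow> bool" where
  "finitely_generated G \<longleftrightarrow> (\<exists>S. finite S \<and> S \<subseteq> carrier G \<and> generate G S = carrier G)"

definition symmetric_measure :: "('a, 'b) monoid_scheme \<Rightarrow> 'a pmf \<Rightarrow> bool" where
  "symmetric_measure H \<phi> \<longleftrightarrow>
     set_pmf \<phi> \<subseteq> carrier H \<and> (\<forall>y\<in>carrier H. pmf \<phi> (inv\<^bsub>H\<^esub> y) = pmf \<phi> y)"

definition admissible_measure :: "('a, 'b) monoid_scheme \<Rightarrow> 'a pmf \<Rightarrow> bool" where
  "admissible_measure H \<phi> \<longleftrightarrow>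
     symmetric_measure H \<phi> \<and> finite (set_pmf \<phi>) \<and> generate H (set_pmf \<phi>) = carrier H"


definition supp_on :: "('a, 'b) monoid_scheme \<Rightarrow> ('a \<Rightarrow> real) \<Rightarrow> 'a set" where
  "supp_on H f = {x \<in> carrier H. f x \<noteq> 0}"

definition lp_norm :: "('a, 'b) monoid_scheme \<Rightarrow> nat \<Rightarrow> ('a \<Rightarrow> real) \<Rightarrow> real" where
  "lp_norm H p f = root p (\<Sum>\<^sub>\<infinity>x\<in>carrier H. \<bar>f x\<bar> ^ p)"

definition lp_energy ::
  "('a, 'b) monoid_scheme \<Rightarrow> 'a pmf \<Rightarrow> nat \<Rightarrow> ('a \<Rightarrow> real) \<Rightarrow> ennreal" where
  "lp_energy H \<phi> p f = ennreal (1 / 2) *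
     (\<Sum>\<^sub>\<infinity>(x, y)\<in>carrier H \<times> carrier H. ennreal (\<bar>f (y \<otimes>\<^bsub>H\<^esub> x) - f x\<bar> ^ p * pmf \<phi> y))"

text \<open>
  The profile takes values in \<^typ>\<open>ennreal\<close>: for \<open>v < 1\<close> no function is admissible, and the
  infimum of the empty set is \<open>\<infinity>\<close>, as required.
\<close>

definition profile ::
  "nat \<Rightarrow> ('a, 'b) monoid_scheme \<Rightarrow> 'a pmf \<Rightarrow> real \<Rightarrow> ennreal" where
  "profile p H \<phi> v = Inf {lp_energy H \<phi> p f | f.
     finite (supp_on H f) \<and> real (card (supp_on H f)) \<le> v \<and> lp_norm H p f = 1}"


text \<open>The extra point \<open>*\<close> is \<^term>\<open>None\<close>.\<close>

definition pocket_points :: "('a, 'b) monoid_scheme \<Rightarrow> 'a option set" where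
  "pocket_points G = insert None (Some ` carrier G)"

text \<open>
  Elements of \<^const>\<open>BijGroup\<close> are extensional functions, hence the restrictions below.
\<close>

definition pocket_translation :: "('a, 'b) monoid_scheme \<Rightarrow> 'a \<Rightarrow> 'a option \<Rightarrow> 'a option" where
  "pocket_translation G h = restrict (map_option (\<lambda>g. h \<otimes>\<^bsub>G\<^esub> g)) (pocket_points G)"

definition pocket_transposition :: "('a, 'b) monoid_scheme \<Rightarrow> 'a option \<Rightarrow> 'a option" where
  "pocket_transposition G = restrict (Transposition.transpose None (Some \<one>\<^bsub>G\<^esub>)) (pocket_points G)"

definition pocket_extension :: "('a, 'b) monoid_scheme \<Rightarrow> ('a option \<Rightarrow> 'a option) monoid" where
  "pocket_extension G = subgroup_generated (BijGroup (pocket_points G))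
     (insert (pocket_transposition G) (pocket_translation G ` carrier G))"

text \<open>
  \<^const>\<open>subgroup_generated\<close> discards generators outside the carrier; the first two lemmas show
  that nothing is discarded here.
\<close>

lemma pocket_translation_in_Bij:
  assumes "group G" "h \<in> carrier G"
  shows "pocket_translation G h \<in> carrier (BijGroup (pocket_points G))"
proof -
  interpret group G by fact
  have "bij_betw (map_option (\<lambda>g. h \<otimes>\<^bsub>G\<^esub> g)) (pocket_points G) (pocket_points G)"
    unfolding pocket_points_def
    by (rule bij_betw_byWitness[where f' = "map_option (\<lambda>g. inv\<^bsub>G\<^esub> h \<otimes>\<^bsub>G\<^esub> g)"])
       (use assms(2) in \<open>auto simp: m_assoc[symmetric]\<close>)
  then show ?thesis
    by (simp add: BijGroup_def Bij_def pocket_translation_def)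
qed

lemma pocket_transposition_in_Bij:
  assumes "group G"
  shows "pocket_transposition G \<in> carrier (BijGroup (pocket_points G))"
proof -
  interpret group G by fact
  have "bij_betw (Transposition.transpose None (Some \<one>\<^bsub>G\<^esub>)) (pocket_points G) (pocket_points G)"
    unfolding pocket_points_def
    by (rule bij_betw_byWitness[where f' = "Transposition.transpose None (Some \<one>\<^bsub>G\<^esub>)"])
       (auto simp: Transposition.transpose_def)
  then show ?thesis
    by (simp add: BijGroup_def Bij_def pocket_transposition_def)
qed

lemma group_pocket_extension: "group (pocket_extension G)"
  unfolding pocket_extension_def by (simp add: group.group_subgroup_generated group_BijGroup)

lemma group_hom_pocket_translation:
  assumes "group G"
  shows "group_hom G (BijGroup (pocket_points G)) (pocket_translation G)"
proof -
  interpret group G by fact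
  show ?thesis
  proof (intro group_hom.intro group_hom_axioms.intro homI)
    fix h k assume hk: "h \<in> carrier G" "k \<in> carrier G"
    have mem: "pocket_translation G h \<in> Bij (pocket_points G)"
      "pocket_translation G k \<in> Bij (pocket_points G)"
      using hk pocket_translation_in_Bij[OF assms] by (auto simp: BijGroup_def)
    have "pocket_translation G (h \<otimes>\<^bsub>G\<^esub> k) =
      compose (pocket_points G) (pocket_translation G h) (pocket_translation G k)"
      using hk by (auto simp: fun_eq_iff compose_def pocket_translation_def pocket_points_def m_assoc)
    then show "pocket_translation G (h \<otimes>\<^bsub>G\<^esub> k) =
      pocket_translation G h \<otimes>\<^bsub>BijGroup (pocket_points G)\<^esub> pocket_translation G k"
      using mem by (simp add: BijGroup_def)
  qed (fact assms group_BijGroup pocket_translation_in_Bij[OF assms])+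
qed

lemma finitely_generated_pocket_extension:
  assumes "group G" "finitely_generated G"
  shows "finitely_generated (pocket_extension G)"
proof -
  let ?B = "BijGroup (pocket_points G)"
  let ?t = "pocket_translation G" and ?s = "pocket_transposition G"
  interpret B: group ?B by (rule group_BijGroup)
  interpret t: group_hom G ?B ?t by (rule group_hom_pocket_translation[OF assms(1)])
  obtain S where S: "finite S" "S \<subseteq> carrier G" "generate G S = carrier G"
    using assms(2) by (auto simp: finitely_generated_def)
  let ?T = "insert ?s (?t ` S)" and ?U = "insert ?s (?t ` carrier G)"
  have U: "?U \<subseteq> carrier ?B"
    using pocket_transposition_in_Bij[OF assms(1)] by auto
  have T: "?T \<subseteq> ?U" using S(2) by auto
  have P: "pocket_extension G = ?B\<lparr>carrier := generate ?B ?U\<rparr>"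
    unfolding pocket_extension_def subgroup_generated_def using U by (simp add: Int_absorb1)
  have "?t ` carrier G = generate ?B (?t ` S)"
    using t.generate_img[OF S(2)] S(3) by simp
  also have "\<dots> \<subseteq> generate ?B ?T" by (rule B.mono_generate) auto
  finally have "?U \<subseteq> generate ?B ?T" by (auto intro: generate.incl)
  then have "generate ?B ?U \<subseteq> generate ?B ?T"
    using T U by (intro B.generate_subgroup_incl B.generate_is_subgroup) auto
  then have eq: "generate ?B ?T = generate ?B ?U"
    using B.mono_generate[OF T] by auto
  have TU: "?T \<subseteq> generate ?B ?U" using T generate.incl[of _ ?U ?B] by blast
  have "generate (pocket_extension G) ?T = generate ?B ?T"
    unfolding P by (rule B.generate_consistent[OF TU B.generate_is_subgroup[OF U]])
  then show ?thesis
    unfolding finitely_generated_def using S(1) TU eq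
    by (intro exI[of _ ?T]) (auto simp: P)
qed

end

theory Submission
  imports Defs "HOL-Combinatorics.Permutations"
begin

text \<open>
  An element of the pocket extension is a pair of an element of \<open>G\<close> (its drift) and a finitary
  permutation. Left translations move only the drift \<open>g\<close>, while the transposition composes the
  permutation with \<open>(*, g\<^sup>-\<^sup>1)\<close>.

  Upper bound: given \<open>f\<close> on \<open>G\<close> with support \<open>U\<close> of size \<open>n\<close>, extend it by \<open>f(g)\<close> on all pairs whose
  permutation lives on \<open>U\<^sup>-\<^sup>1 \<union> {*}\<close>, and by \<open>0\<close> elsewhere. The transposition costs nothing, and the
  support has at most \<open>n (n+1)!\<close> elements.

  Lower bound: let \<open>F\<close> have support of size at most \<open>v < (k+1)!\<close>. Truncate \<open>|F|\<close> on each fibre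
  (fixed permutation) at its \<open>(n+1)\<close>-st largest value, \<open>n = 3k\<close>. The part above the
  truncation level has support at most \<open>n\<close>, so its mass is controlled by the translation energy and
  \<open>\<Lambda>\<^bsub>p,G\<^esub>(n)\<close>. Below the truncation level the superlevel sets of \<open>|F|\<^sup>p\<close> have fibres with more than
  \<open>n\<close> points. If few points of such a set left it under the transposition, some union of its fibres
  would give a set of permutations each having at least \<open>k+1\<close> neighbours \<open>(*, u)\<sigma>\<close> within the set;
  such a set has at least \<open>(k+1)!\<close> elements, which is more than \<open>v\<close>. Hence the remaining mass is
  controlled by the energy of the transposition alone, with an absolute constant, and there is no
  loss in passing from \<open>p = 2\<close> to level sets.
\<close>

section \<open>Energies on groups\<close>

lemma powp_add_le:
  fixes a b :: real
  assumes "p = 1 \<or> p = (2::nat)"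
  shows "\<bar>a + b\<bar> ^ p \<le> 2 * (\<bar>a\<bar> ^ p + \<bar>b\<bar> ^ p)"
proof -
  have "0 \<le> (a - b)\<^sup>2" by simp
  then have "(a + b)\<^sup>2 \<le> 2 * (a\<^sup>2 + b\<^sup>2)" by (simp add: power2_eq_square algebra_simps)
  then show ?thesis using assms by (auto intro: order_trans[OF abs_triangle_ineq])
qed

text \<open>A difference of powers is traded for a power of the difference, at the price of a small
  multiple of the powers themselves that is later absorbed into the total mass. For
  \<open>p = 2\<close> this takes the place of Cauchy-Schwarz.\<close>

lemma powp_diff_le:
  fixes a b \<eta> :: real
  assumes "p = 1 \<or> p = (2::nat)" "0 < \<eta>" "\<eta> \<le> 1" "0 \<le> a" "0 \<le> b"
  shows "a ^ p - b ^ p \<le> (1 / \<eta>) * \<bar>a - b\<bar> ^ p + \<eta> * (a ^ p + b ^ p)"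
  using assms(1)
proof
  assume p: "p = 1"
  have "\<bar>a - b\<bar> * 1 \<le> \<bar>a - b\<bar> * (1 / \<eta>)"
    using assms by (intro mult_left_mono) auto
  moreover have "0 \<le> \<eta> * (a + b)" using assms by simp
  ultimately show ?thesis using p by (simp add: mult.commute)
next
  assume p: "p = 2"
  \<comment> \<open>On expansion the mixed terms add up to
    \<open>- 2 * \<eta> * (a - b) * (a + b)\<close>, which carries the difference of
    squares.\<close>
  have "0 \<le> (a - b - \<eta> * a)\<^sup>2 + (a - b - \<eta> * b)\<^sup>2" by simp
  then have "2 * \<eta> * (a\<^sup>2 - b\<^sup>2) \<le> 2 * (a - b)\<^sup>2 + \<eta>\<^sup>2 * (a\<^sup>2 + b\<^sup>2)"
    by (simp add: power2_eq_square algebra_simps)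
  also have "\<dots> \<le> 2 * (a - b)\<^sup>2 + 2 * \<eta>\<^sup>2 * (a\<^sup>2 + b\<^sup>2)" by simp
  finally have "\<eta> * (a\<^sup>2 - b\<^sup>2) \<le> (a - b)\<^sup>2 + \<eta>\<^sup>2 * (a\<^sup>2 + b\<^sup>2)" by simp
  then have "a\<^sup>2 - b\<^sup>2 \<le> ((a - b)\<^sup>2 + \<eta>\<^sup>2 * (a\<^sup>2 + b\<^sup>2)) / \<eta>"
    using assms(2) by (simp add: pos_le_divide_eq mult.commute)
  also have "\<dots> = (1 / \<eta>) * (a - b)\<^sup>2 + \<eta> * (a\<^sup>2 + b\<^sup>2)"
    using assms(2) by (simp add: field_simps power2_eq_square)
  finally show ?thesis using p by simp
qed

text \<open>The \<open>p\<close>-th power of the \<open>p\<close>-norm of the difference of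
  \<open>f\<close> and its translate by \<open>y\<close>. Summing only over the points where the
  value changes gives a finite sum whenever \<open>f\<close> has finite support and \<open>y\<close>
  lies in the group.\<close>

definition disp :: "('a, 'b) monoid_scheme \<Rightarrow> nat \<Rightarrow> ('a \<Rightarrow> real) \<Rightarrow> 'a \<Rightarrow> real" where
  "disp H p f y = (\<Sum>x | x \<in> carrier H \<and> f (y \<otimes>\<^bsub>H\<^esub> x) \<noteq> f x. \<bar>f (y \<otimes>\<^bsub>H\<^esub> x) - f x\<bar> ^ p)"

definition mass :: "('a, 'b) monoid_scheme \<Rightarrow> nat \<Rightarrow> ('a \<Rightarrow> real) \<Rightarrow> real" where
  "mass H p f = (\<Sum>x\<in>supp_on H f. \<bar>f x\<bar> ^ p)"

definition energy :: "('a, 'b) monoid_scheme \<Rightarrow> 'a pmf \<Rightarrow> nat \<Rightarrow> ('a \<Rightarrow> real) \<Rightarrow> real" where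
  "energy H \<phi> p f = 1 / 2 * (\<Sum>y\<in>set_pmf \<phi>. pmf \<phi> y * disp H p f y)"

lemma disp_nonneg: "0 \<le> disp H p f y"
  unfolding disp_def by (intro sum_nonneg) auto

lemma mass_nonneg: "0 \<le> mass H p f"
  unfolding mass_def by (intro sum_nonneg) auto

lemma energy_nonneg: "0 \<le> energy H \<phi> p f"
  unfolding energy_def by (intro mult_nonneg_nonneg sum_nonneg) (auto simp: disp_nonneg)

lemma mass_eq_sum:
  assumes "finite Z" "supp_on H f \<subseteq> Z" "Z \<subseteq> carrier H" "p > 0"
  shows "mass H p f = (\<Sum>x\<in>Z. \<bar>f x\<bar> ^ p)"
  unfolding mass_def using assms by (intro sum.mono_neutral_left) (auto simp: supp_on_def)

lemma disp_eq_sum: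
  assumes "finite Z" "{x \<in> carrier H. f (y \<otimes>\<^bsub>H\<^esub> x) \<noteq> f x} \<subseteq> Z" "Z \<subseteq> carrier H" "p > 0"
  shows "disp H p f y = (\<Sum>x\<in>Z. \<bar>f (y \<otimes>\<^bsub>H\<^esub> x) - f x\<bar> ^ p)"
  unfolding disp_def using assms by (intro sum.mono_neutral_left) auto

lemma mass_cmult:
  assumes "c \<noteq> 0"
  shows "mass H p (\<lambda>x. c * f x) = \<bar>c\<bar> ^ p * mass H p f"
  using assms by (simp add: mass_def supp_on_def abs_mult power_mult_distrib sum_distrib_left)

lemma disp_cmult:
  assumes "c \<noteq> 0"
  shows "disp H p (\<lambda>x. c * f x) y = \<bar>c\<bar> ^ p * disp H p f y"
proof -
  have "c * a - c * b = c * (a - b)" for a b by (simp add: algebra_simps)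
  then show ?thesis
    using assms by (simp add: disp_def abs_mult power_mult_distrib sum_distrib_left)
qed

lemma energy_cmult:
  assumes "c \<noteq> 0"
  shows "energy H \<phi> p (\<lambda>x. c * f x) = \<bar>c\<bar> ^ p * energy H \<phi> p f"
  using assms by (simp add: energy_def disp_cmult sum_distrib_left mult_ac)

lemma mass_pos:
  assumes "finite (supp_on H f)" "supp_on H f \<noteq> {}"
  shows "0 < mass H p f"
  unfolding mass_def using assms by (intro sum_pos) (auto simp: supp_on_def)

lemma lp_norm_eq_mass:
  assumes "finite (supp_on H f)" "p > 0"
  shows "lp_norm H p f = root p (mass H p f)"
proof -
  have "(\<Sum>\<^sub>\<infinity>x\<in>carrier H. \<bar>f x\<bar> ^ p) = (\<Sum>\<^sub>\<infinity>x\<in>supp_on H f. \<bar>f x\<bar> ^ p)"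
    using assms(2) by (intro infsum_cong_neutral) (auto simp: supp_on_def)
  then show ?thesis using assms(1) by (simp add: lp_norm_def mass_def)
qed

lemma lp_norm_eq_1_iff:
  assumes "finite (supp_on H f)" "p > 0"
  shows "lp_norm H p f = 1 \<longleftrightarrow> mass H p f = 1"
  using assms by (simp add: lp_norm_eq_mass)

section \<open>Dispersion along words, and the profile as a homogeneous inequality\<close>

context group
begin

lemma finite_disp_support:
  assumes "finite (supp_on G f)" "y \<in> carrier G"
  shows "finite {x \<in> carrier G. f (y \<otimes> x) \<noteq> f x}"
proof (rule finite_subset)
  show "{x \<in> carrier G. f (y \<otimes> x) \<noteq> f x} \<subseteq> supp_on G f \<union> (\<lambda>z. inv y \<otimes> z) ` supp_on G f"
  proof safe
    fix x assume x: "x \<in> carrier G" "f (y \<otimes> x) \<noteq> f x" "x \<notin> (\<lambda>z. inv y \<otimes> z) ` supp_on G f"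
    have "x = inv y \<otimes> (y \<otimes> x)" using x assms by (simp add: m_assoc[symmetric])
    then have "y \<otimes> x \<notin> supp_on G f" using x(3) by blast
    then show "x \<in> supp_on G f" using x assms by (auto simp: supp_on_def)
  qed
qed (use assms in auto)

lemma disp_one: "disp G p f \<one> = 0"
  unfolding disp_def by (rule sum.neutral) auto

lemma disp_inv:
  assumes "y \<in> carrier G"
  shows "disp G p f (inv y) = disp G p f y"
  unfolding disp_def
  by (rule sum.reindex_bij_witness[where i = "\<lambda>x. y \<otimes> x" and j = "\<lambda>x. inv y \<otimes> x"])
     (use assms in \<open>auto simp: m_assoc[symmetric] abs_minus_commute\<close>)

text \<open>The change from \<open>x\<close> to \<open>a b x\<close> is split at \<open>b x\<close>;
  after the substitution of \<open>b x\<close> for \<open>x\<close> the two halves are the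
  dispersions of \<open>a\<close> and \<open>b\<close>, and \<open>powp_add_le\<close> supplies the
  factor 2.\<close>

lemma disp_mult:
  assumes f: "finite (supp_on G f)" and ab: "a \<in> carrier G" "b \<in> carrier G"
    and p: "p = 1 \<or> p = 2"
  shows "disp G p f (a \<otimes> b) \<le> 2 * (disp G p f a + disp G p f b)"
proof -
  have p0: "p > 0" using p by auto
  define Za where "Za = {x \<in> carrier G. f (a \<otimes> x) \<noteq> f x}"
  define Zb where "Zb = {x \<in> carrier G. f (b \<otimes> x) \<noteq> f x}"
  \<comment> \<open>A common finite domain: off \<open>Z\<close> neither half changes the value, and
    the translate of \<open>Z\<close> by \<open>b\<close> contains every point whose value
    \<open>a\<close> changes.\<close>
  define Z where "Z = (\<lambda>x. inv b \<otimes> x) ` Za \<union> Zb"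
  have fin: "finite Za" "finite Zb" "finite Z"
    unfolding Z_def Za_def Zb_def using finite_disp_support[OF f] ab by auto
  have Zc: "Z \<subseteq> carrier G" unfolding Z_def Za_def Zb_def using ab by auto
  have sub: "{x \<in> carrier G. f (a \<otimes> b \<otimes> x) \<noteq> f x} \<subseteq> Z"
  proof (safe, rule ccontr)
    fix x assume x: "x \<in> carrier G" "f (a \<otimes> b \<otimes> x) \<noteq> f x" and nz: "x \<notin> Z"
    have "f (b \<otimes> x) = f x" using nz x unfolding Z_def Zb_def by auto
    moreover have "x = inv b \<otimes> (b \<otimes> x)" using x ab by (simp add: m_assoc[symmetric])
    then have "b \<otimes> x \<notin> Za" using nz unfolding Z_def by blast
    then have "f (a \<otimes> (b \<otimes> x)) = f (b \<otimes> x)" unfolding Za_def using x ab by auto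
    ultimately show False using x ab by (simp add: m_assoc)
  qed
  have 1: "disp G p f (a \<otimes> b) = (\<Sum>x\<in>Z. \<bar>f (a \<otimes> b \<otimes> x) - f x\<bar> ^ p)"
    by (rule disp_eq_sum[OF fin(3) sub Zc p0])
  have 2: "disp G p f b = (\<Sum>x\<in>Z. \<bar>f (b \<otimes> x) - f x\<bar> ^ p)"
    by (rule disp_eq_sum[OF fin(3) _ Zc p0]) (auto simp: Z_def Zb_def)
  have inj: "inj_on (\<lambda>x. b \<otimes> x) Z"
    using ab Zc by (auto simp: inj_on_def subset_iff)
  have "disp G p f a = (\<Sum>x\<in>(\<lambda>x. b \<otimes> x) ` Z. \<bar>f (a \<otimes> x) - f x\<bar> ^ p)"
  proof (rule disp_eq_sum[OF _ _ _ p0])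
    show "{x \<in> carrier G. f (a \<otimes> x) \<noteq> f x} \<subseteq> (\<lambda>x. b \<otimes> x) ` Z"
    proof
      fix x assume "x \<in> {x \<in> carrier G. f (a \<otimes> x) \<noteq> f x}"
      then have "x = b \<otimes> (inv b \<otimes> x)" "inv b \<otimes> x \<in> Z"
        using ab by (auto simp: Z_def Za_def m_assoc[symmetric])
      then show "x \<in> (\<lambda>x. b \<otimes> x) ` Z" by blast
    qed
  qed (use fin Zc ab in auto)
  also have "\<dots> = (\<Sum>x\<in>Z. \<bar>f (a \<otimes> (b \<otimes> x)) - f (b \<otimes> x)\<bar> ^ p)"
    using inj by (simp add: sum.reindex)
  finally have 3: "disp G p f a = (\<Sum>x\<in>Z. \<bar>f (a \<otimes> (b \<otimes> x)) - f (b \<otimes> x)\<bar> ^ p)" .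
  have "(\<Sum>x\<in>Z. \<bar>f (a \<otimes> b \<otimes> x) - f x\<bar> ^ p)
      \<le> (\<Sum>x\<in>Z. 2 * (\<bar>f (a \<otimes> (b \<otimes> x)) - f (b \<otimes> x)\<bar> ^ p + \<bar>f (b \<otimes> x) - f x\<bar> ^ p))"
  proof (rule sum_mono)
    fix x assume "x \<in> Z"
    then have "a \<otimes> b \<otimes> x = a \<otimes> (b \<otimes> x)" using Zc ab by (auto simp: m_assoc)
    then show "\<bar>f (a \<otimes> b \<otimes> x) - f x\<bar> ^ p
      \<le> 2 * (\<bar>f (a \<otimes> (b \<otimes> x)) - f (b \<otimes> x)\<bar> ^ p + \<bar>f (b \<otimes> x) - f x\<bar> ^ p)"
      using powp_add_le[OF p, of "f (a \<otimes> (b \<otimes> x)) - f (b \<otimes> x)" "f (b \<otimes> x) - f x"] by simp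
  qed
  then show ?thesis
    unfolding 1 2 3 by (simp add: sum_distrib_left sum.distrib distrib_left)
qed

text \<open>Bounds on generators spread along words by \<open>disp_inv\<close> and
  \<open>disp_mult\<close>. The constant depends on \<open>y\<close> but not on \<open>i\<close>.
  The bound \<open>B i\<close> is left free so that it can be the energy of \<open>f i\<close>
  itself or that of a function on another group from which \<open>f i\<close> was built.\<close>

lemma disp_generate_le:
  assumes S: "S \<subseteq> carrier G" and p: "p = 1 \<or> p = 2"
    and f: "\<And>i. i \<in> I \<Longrightarrow> finite (supp_on G (f i))"
    and B: "\<And>i. i \<in> I \<Longrightarrow> 0 \<le> B i"
    and gen: "\<And>s. s \<in> S \<Longrightarrow> \<exists>C::real. \<forall>i\<in>I. disp G p (f i) s \<le> C * B i"
    and y: "y \<in> generate G S"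
  shows "\<exists>C>0. \<forall>i\<in>I. disp G p (f i) y \<le> C * B i"
proof -
  have "\<exists>C. \<forall>i\<in>I. disp G p (f i) y \<le> C * B i"
    using y
  proof induction
    case one
    show ?case using B by (auto simp: disp_one intro: exI[of _ 0])
  next
    case (incl h) then show ?case using gen by auto
  next
    case (inv h) then show ?case using gen S by (simp add: disp_inv subset_iff)
  next
    case (eng a b)
    then obtain C D where CD: "\<And>i. i \<in> I \<Longrightarrow> disp G p (f i) a \<le> C * B i"
      "\<And>i. i \<in> I \<Longrightarrow> disp G p (f i) b \<le> D * B i" by blast
    have ab: "a \<in> carrier G" "b \<in> carrier G"
      using eng.hyps generate_in_carrier[OF S] by auto
    have "disp G p (f i) (a \<otimes> b) \<le> (2 * (C + D)) * B i" if "i \<in> I" for i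
      using disp_mult[OF f[OF that] ab p] CD[OF that] by (simp add: algebra_simps)
    then show ?case by blast
  qed
  then obtain C where C: "\<And>i. i \<in> I \<Longrightarrow> disp G p (f i) y \<le> C * B i" by blast
  have "disp G p (f i) y \<le> (\<bar>C\<bar> + 1) * B i" if "i \<in> I" for i
    using C[OF that] B[OF that] mult_right_mono[of C "\<bar>C\<bar> + 1" "B i"] by linarith
  then show ?thesis by (intro exI[of _ "\<bar>C\<bar> + 1"]) auto
qed

text \<open>Each element of the support of \<open>\<phi>\<close> enters the energy with positive
  weight, which bounds its dispersion; all other elements are words in the support.\<close>

lemma disp_le_energy:
  assumes \<phi>: "admissible_measure G \<phi>" and p: "p = 1 \<or> p = 2" and y: "y \<in> carrier G"
  shows "\<exists>C>0. \<forall>f. finite (supp_on G f) \<longrightarrow> disp G p f y \<le> C * energy G \<phi> p f"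
proof -
  have fin: "finite (set_pmf \<phi>)" and sub: "set_pmf \<phi> \<subseteq> carrier G"
    and gen: "generate G (set_pmf \<phi>) = carrier G"
    using \<phi> by (auto simp: admissible_measure_def symmetric_measure_def)
  have "\<exists>C>0. \<forall>f\<in>{f. finite (supp_on G f)}. disp G p f y \<le> C * energy G \<phi> p f"
  proof (rule disp_generate_le[OF sub p])
    fix s assume s: "s \<in> set_pmf \<phi>"
    have pos: "0 < pmf \<phi> s" using s by (simp add: pmf_positive)
    have "disp G p f s \<le> (2 / pmf \<phi> s) * energy G \<phi> p f" for f
    proof -
      have "pmf \<phi> s * disp G p f s \<le> (\<Sum>y\<in>set_pmf \<phi>. pmf \<phi> y * disp G p f y)"
        by (rule member_le_sum[OF s _ fin]) (simp add: disp_nonneg)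
      then show ?thesis using pos by (simp add: energy_def field_simps)
    qed
    then show "\<exists>C. \<forall>f\<in>{f. finite (supp_on G f)}. disp G p f s \<le> C * energy G \<phi> p f" by blast
  qed (use y gen energy_nonneg in auto)
  then show ?thesis by simp
qed

text \<open>A pair contributes only if \<open>y\<close> has positive weight and moves the value of
  \<open>f\<close> at \<open>x\<close>. There are finitely many such pairs, so the infinite
  \<open>ennreal\<close> sum is a finite real one.\<close>

lemma lp_energy_eq_energy:
  assumes f: "finite (supp_on G f)" and \<phi>: "finite (set_pmf \<phi>)" "set_pmf \<phi> \<subseteq> carrier G"
    and p: "p > 0"
  shows "lp_energy G \<phi> p f = ennreal (energy G \<phi> p f)"
proof -
  define Z where "Z = (\<Union>y\<in>set_pmf \<phi>. {x \<in> carrier G. f (y \<otimes> x) \<noteq> f x})"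
  have Z: "finite Z" "Z \<subseteq> carrier G"
    unfolding Z_def using finite_disp_support[OF f] \<phi> by auto
  have "(\<Sum>\<^sub>\<infinity>(x, y)\<in>carrier G \<times> carrier G. ennreal (\<bar>f (y \<otimes> x) - f x\<bar> ^ p * pmf \<phi> y))
      = (\<Sum>\<^sub>\<infinity>(x, y)\<in>Z \<times> set_pmf \<phi>. ennreal (\<bar>f (y \<otimes> x) - f x\<bar> ^ p * pmf \<phi> y))"
  proof (rule infsum_cong_neutral)
    fix z assume z: "z \<in> carrier G \<times> carrier G - Z \<times> set_pmf \<phi>"
    obtain x y where xy: "z = (x, y)" by force
    have "f (y \<otimes> x) = f x \<or> pmf \<phi> y = 0"
      using z xy by (auto simp: Z_def set_pmf_iff)
    then show "(case z of (x, y) \<Rightarrow> ennreal (\<bar>f (y \<otimes> x) - f x\<bar> ^ p * pmf \<phi> y)) = 0"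
      using xy p by auto
  qed (use Z \<phi> in auto)
  also have "\<dots> = (\<Sum>(x, y)\<in>Z \<times> set_pmf \<phi>. ennreal (\<bar>f (y \<otimes> x) - f x\<bar> ^ p * pmf \<phi> y))"
    using Z \<phi> by (intro infsum_finite) auto
  also have "\<dots> = ennreal (\<Sum>(x, y)\<in>Z \<times> set_pmf \<phi>. \<bar>f (y \<otimes> x) - f x\<bar> ^ p * pmf \<phi> y)"
    by (subst sum_ennreal[symmetric]) (auto intro!: sum.cong)
  also have "(\<Sum>(x, y)\<in>Z \<times> set_pmf \<phi>. \<bar>f (y \<otimes> x) - f x\<bar> ^ p * pmf \<phi> y)
     = (\<Sum>y\<in>set_pmf \<phi>. \<Sum>x\<in>Z. \<bar>f (y \<otimes> x) - f x\<bar> ^ p * pmf \<phi> y)"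
    by (subst sum.swap) (simp add: sum.cartesian_product)
  also have "\<dots> = (\<Sum>y\<in>set_pmf \<phi>. pmf \<phi> y * disp G p f y)"
  proof (rule sum.cong[OF refl])
    fix y assume "y \<in> set_pmf \<phi>"
    then have "disp G p f y = (\<Sum>x\<in>Z. \<bar>f (y \<otimes> x) - f x\<bar> ^ p)"
      by (intro disp_eq_sum Z p) (auto simp: Z_def)
    then show "(\<Sum>x\<in>Z. \<bar>f (y \<otimes> x) - f x\<bar> ^ p * pmf \<phi> y) = pmf \<phi> y * disp G p f y"
      by (simp add: sum_distrib_left mult.commute)
  qed
  finally show ?thesis
    unfolding lp_energy_def energy_def
    by (simp only: ennreal_mult'[of "1 / 2", symmetric] zero_le_divide_1_iff zero_le_numeral)
qed

text \<open>Energy and mass are both homogeneous of degree \<open>p\<close>, so \<open>f\<close> can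
  be normalized. The product form also covers functions vanishing on the group, since an infinite
  profile times \<open>0\<close> is \<open>0\<close>.\<close>

lemma profile_mult_mass_le:
  assumes \<phi>: "finite (set_pmf \<phi>)" "set_pmf \<phi> \<subseteq> carrier G" and p: "p > 0"
    and f: "finite (supp_on G f)" "real (card (supp_on G f)) \<le> v"
  shows "profile p G \<phi> v * ennreal (mass G p f) \<le> ennreal (energy G \<phi> p f)"
proof (cases "supp_on G f = {}")
  case True
  then show ?thesis by (simp add: mass_def)
next
  case False
  define M where "M = mass G p f"
  have M: "M > 0" unfolding M_def using mass_pos f False by blast
  define c where "c = 1 / root p M"
  have c0: "c > 0" and cp: "\<bar>c\<bar> ^ p = 1 / M"
    using M p by (auto simp: c_def power_divide real_root_gt_zero)
  let ?g = "\<lambda>x. c * f x"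
  have supp: "supp_on G ?g = supp_on G f" using c0 by (auto simp: supp_on_def)
  have "mass G p ?g = 1" using c0 cp M by (simp add: mass_cmult M_def)
  then have "lp_norm G p ?g = 1" using f p supp by (simp add: lp_norm_eq_1_iff)
  then have "profile p G \<phi> v \<le> lp_energy G \<phi> p ?g"
    unfolding profile_def using f supp by (intro Inf_lower) auto
  also have "\<dots> = ennreal (energy G \<phi> p f / M)"
    using c0 cp f \<phi> p supp by (simp add: lp_energy_eq_energy energy_cmult)
  finally have "profile p G \<phi> v * ennreal M \<le> ennreal (energy G \<phi> p f / M) * ennreal M"
    by (rule mult_right_mono) simp
  also have "\<dots> = ennreal (energy G \<phi> p f)"
    using M by (simp add: ennreal_mult[symmetric] energy_nonneg)
  finally show ?thesis by (simp add: M_def)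
qed

lemma profile_greatest:
  assumes \<phi>: "finite (set_pmf \<phi>)" "set_pmf \<phi> \<subseteq> carrier G" and p: "p > 0"
    and X: "\<And>f. finite (supp_on G f) \<Longrightarrow> real (card (supp_on G f)) \<le> v \<Longrightarrow> mass G p f = 1
      \<Longrightarrow> X \<le> ennreal (energy G \<phi> p f)"
  shows "X \<le> profile p G \<phi> v"
  unfolding profile_def
proof (rule Inf_greatest, clarify)
  fix f assume "finite (supp_on G f)" "real (card (supp_on G f)) \<le> v" "lp_norm G p f = 1"
  then show "X \<le> lp_energy G \<phi> p f"
    using X[of f] \<phi> p by (simp add: lp_energy_eq_energy lp_norm_eq_1_iff)
qed

end

lemma profile_antimono:
  assumes "u \<le> v"
  shows "profile p H \<phi> v \<le> profile p H \<phi> u"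
  unfolding profile_def using assms by (intro Inf_superset_mono) force

section \<open>Combinatorics of level sets\<close>

text \<open>Induction step: some label \<open>a\<close> sits at \<open>b\<close>; its neighbours put \<open>a\<close> at at least \<open>m + 1\<close> other
  places \<open>q\<close>, and within the class of those with \<open>a\<close> at \<open>q\<close> only one neighbour is lost.\<close>

lemma star_graph_card_ge_fact:
  fixes A :: "('l \<Rightarrow> 'b) set"
  assumes "finite A" "A \<noteq> {}"
    and surj: "\<And>\<sigma>. \<sigma> \<in> A \<Longrightarrow> \<exists>l\<in>X. \<sigma> l = b"
    and deg: "\<And>\<sigma>. \<sigma> \<in> A \<Longrightarrow> \<exists>U. finite U \<and> m \<le> card U \<and> b \<notin> U \<and>
      (\<forall>u\<in>U. \<exists>\<sigma>'\<in>A. \<forall>l\<in>X. \<sigma>' l = Transposition.transpose b u (\<sigma> l))"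
  shows "fact m \<le> card A"
  using assms
proof (induction m arbitrary: A)
  case 0
  then show ?case by (simp add: Suc_leI card_gt_0_iff)
next
  case (Suc m)
  obtain \<sigma>0 where \<sigma>0: "\<sigma>0 \<in> A" using Suc.prems(2) by blast
  obtain a where a: "a \<in> X" "\<sigma>0 a = b" using Suc.prems(3)[OF \<sigma>0] by blast
  obtain U where U: "finite U" "Suc m \<le> card U" "b \<notin> U"
    "\<And>u. u \<in> U \<Longrightarrow> \<exists>\<sigma>'\<in>A. \<forall>l\<in>X. \<sigma>' l = Transposition.transpose b u (\<sigma>0 l)"
    using Suc.prems(4)[OF \<sigma>0] by blast
  define B where "B q = {\<sigma> \<in> A. \<sigma> a = q}" for q
  have "fact m \<le> card (B q)" if q: "q \<in> U" for q
  proof (rule Suc.IH)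
    show "finite (B q)" using Suc.prems(1) by (simp add: B_def)
    obtain \<sigma>' where "\<sigma>' \<in> A" "\<forall>l\<in>X. \<sigma>' l = Transposition.transpose b q (\<sigma>0 l)"
      using U(4)[OF q] by blast
    then have "\<sigma>' \<in> B q" using a by (simp add: B_def)
    then show "B q \<noteq> {}" by blast
  next
    fix \<sigma> assume \<sigma>: "\<sigma> \<in> B q"
    then have \<sigma>A: "\<sigma> \<in> A" and \<sigma>a: "\<sigma> a = q" by (auto simp: B_def)
    show "\<exists>l\<in>X. \<sigma> l = b" using Suc.prems(3)[OF \<sigma>A] .
    obtain V where V: "finite V" "Suc m \<le> card V" "b \<notin> V"
      "\<And>u. u \<in> V \<Longrightarrow> \<exists>\<sigma>'\<in>A. \<forall>l\<in>X. \<sigma>' l = Transposition.transpose b u (\<sigma> l)"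
      using Suc.prems(4)[OF \<sigma>A] by blast
    show "\<exists>U. finite U \<and> m \<le> card U \<and> b \<notin> U \<and>
      (\<forall>u\<in>U. \<exists>\<sigma>'\<in>B q. \<forall>l\<in>X. \<sigma>' l = Transposition.transpose b u (\<sigma> l))"
    proof (intro exI[of _ "V - {q}"] conjI ballI)
      show "m \<le> card (V - {q})" using V(2) by (auto simp: card_Diff_singleton_if)
      fix u assume u: "u \<in> V - {q}"
      then obtain \<sigma>' where \<sigma>': "\<sigma>' \<in> A" "\<forall>l\<in>X. \<sigma>' l = Transposition.transpose b u (\<sigma> l)"
        using V(4)[of u] by blast
      have "q \<noteq> b" using q U(3) by blast
      then have "\<sigma>' a = q" using \<sigma>' a u \<sigma>a by (auto simp: Transposition.transpose_def)
      then show "\<exists>\<sigma>'\<in>B q. \<forall>l\<in>X. \<sigma>' l = Transposition.transpose b u (\<sigma> l)"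
        using \<sigma>' by (auto simp: B_def)
    qed (use V in auto)
  qed
  then have "card U * fact m \<le> (\<Sum>q\<in>U. card (B q))"
    using sum_bounded_below[of U "fact m" "\<lambda>q. card (B q)"] by simp
  also have "\<dots> = card (\<Union>q\<in>U. B q)"
    using U(1) Suc.prems(1) by (intro card_UN_disjoint[symmetric]) (auto simp: B_def)
  also have "\<dots> \<le> card A"
    using Suc.prems(1) by (intro card_mono) (auto simp: B_def)
  finally have "card U * fact m \<le> card A" .
  moreover have "Suc m * fact m \<le> card U * fact m" using U(2) by (rule mult_right_mono) simp
  ultimately show ?case by (simp only: fact_Suc of_nat_id)
qed

text \<open>\<open>A\<close> minimizes boundary plus twice the small fibres minus a third of the total size;
  deleting a single fibre from a minimizer cannot lower this quantity.\<close>

lemma exists_satisfied_fibres: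
  fixes S :: "'x set" and c :: "'x \<Rightarrow> 'r" and \<tau> :: "'x \<Rightarrow> 'x"
  assumes S: "finite S"
    and inv: "\<And>x. x \<in> S \<Longrightarrow> \<tau> (\<tau> x) = x"
    and small: "3 * card {x \<in> S. \<tau> x \<notin> S} + 6 * card {x \<in> S. card {y \<in> S. c y = c x} \<le> n} < card S"
  obtains A where "A \<noteq> {}" "A \<subseteq> c ` S"
    "\<And>r. r \<in> A \<Longrightarrow> n < 3 * card {x \<in> S. c x = r \<and> \<tau> x \<in> S \<and> c (\<tau> x) \<in> A}"
proof -
  define P where "P A = {x \<in> S. c x \<in> A}" for A
  define small where "small = {x \<in> S. card {y \<in> S. c y = c x} \<le> n}"
  define J where "J A = 3 * int (card {x \<in> P A. \<tau> x \<notin> P A}) + 6 * int (card (P A \<inter> small))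
      - int (card (P A))" for A
  have finP: "finite (P A)" for A using S by (simp add: P_def)
  define \<A> where "\<A> = Pow (c ` S)"
  have fin\<A>: "finite \<A>" "\<A> \<noteq> {}" using S by (auto simp: \<A>_def)
  obtain A where A: "A \<in> \<A>" and Amin: "\<And>B. B \<in> \<A> \<Longrightarrow> J A \<le> J B"
    using ex_min_if_finite[of "J ` \<A>"] fin\<A> by (metis (no_types, lifting) arg_min_if_finite(1) arg_min_least)
  have "P (c ` S) = S" by (auto simp: P_def)
  \<comment> \<open>The hypothesis says that \<open>J\<close> is negative on the set of all labels,
    whereas \<open>J {} = 0\<close>; hence the minimizer is nonempty.\<close>
  then have "J (c ` S) < 0" using assms(3) by (simp add: J_def small_def Int_def conj_commute)
  then have "J A < 0" using Amin[of "c ` S"] by (simp add: \<A>_def)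
  then have "A \<noteq> {}" by (auto simp: J_def P_def)
  moreover have "A \<subseteq> c ` S" using A by (simp add: \<A>_def)
  moreover have "n < 3 * card {x \<in> S. c x = r \<and> \<tau> x \<in> S \<and> c (\<tau> x) \<in> A}" if r: "r \<in> A" for r
  proof -
    define F where "F = {x \<in> S. c x = r}"
    define sat where "sat = {x \<in> F. \<tau> x \<in> P A}"
    define uns where "uns = {x \<in> F. \<tau> x \<notin> P A}"
    let ?B = "A - {r}"
    have finF: "finite F" "finite sat" "finite uns" using S by (auto simp: F_def sat_def uns_def)
    have FP: "F \<subseteq> P A" using r by (auto simp: F_def P_def)
    have PB: "P ?B = P A - F" by (auto simp: P_def F_def)
    have cF: "card F = card sat + card uns"
      using finF by (subst card_Un_disjoint[symmetric]) (auto simp: sat_def uns_def intro: arg_cong[of _ _ card])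
    have cP: "card (P A) = card (P ?B) + card F"
      using FP finP finF card_mono[OF finP FP] unfolding PB by (simp add: card_Diff_subset)
    \<comment> \<open>When the fibre \<open>F\<close> is deleted, the points of \<open>uns\<close>
      leave the boundary, and the only new boundary points are partners under \<tau> of points of
      \<open>sat\<close>.\<close>
    have bd: "card {x \<in> P ?B. \<tau> x \<notin> P ?B} + card uns \<le> card {x \<in> P A. \<tau> x \<notin> P A} + card sat"
    proof -
      have inj: "inj_on \<tau> sat"
        using inv by (intro inj_on_inverseI[of _ \<tau>]) (auto simp: sat_def F_def)
      have "{x \<in> P ?B. \<tau> x \<notin> P ?B} \<union> uns \<subseteq> {x \<in> P A. \<tau> x \<notin> P A} \<union> \<tau> ` sat"
      proof
        fix x assume x: "x \<in> {x \<in> P ?B. \<tau> x \<notin> P ?B} \<union> uns"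
        have xP: "x \<in> P A" using x FP by (auto simp: PB uns_def)
        show "x \<in> {x \<in> P A. \<tau> x \<notin> P A} \<union> \<tau> ` sat"
        proof (cases "\<tau> x \<in> P A")
          case True
          then have "\<tau> x \<in> F" using x by (auto simp: PB uns_def)
          moreover have "\<tau> (\<tau> x) = x" using xP inv by (auto simp: P_def)
          ultimately have "\<tau> x \<in> sat" using xP by (simp add: sat_def)
          then show ?thesis using \<open>\<tau> (\<tau> x) = x\<close> by (metis UnI2 imageI)
        qed (use xP in auto)
      qed
      then have "card ({x \<in> P ?B. \<tau> x \<notin> P ?B} \<union> uns) \<le> card ({x \<in> P A. \<tau> x \<notin> P A} \<union> \<tau> ` sat)"
        using finP finF by (intro card_mono) auto
      also have "\<dots> \<le> card {x \<in> P A. \<tau> x \<notin> P A} + card (\<tau> ` sat)" by (rule card_Un_le)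
      also have "card (\<tau> ` sat) = card sat" using inj by (rule card_image)
      also have "card ({x \<in> P ?B. \<tau> x \<notin> P ?B} \<union> uns) = card {x \<in> P ?B. \<tau> x \<notin> P ?B} + card uns"
        using finP finF by (intro card_Un_disjoint) (auto simp: PB uns_def)
      finally show ?thesis .
    qed
    have sm: "card (P A \<inter> small) = card (P ?B \<inter> small) + card (F \<inter> small)"
      using FP finP finF by (subst card_Un_disjoint[symmetric]) (auto simp: PB intro: arg_cong[of _ _ card])
    \<comment> \<open>Minimality against deletion of \<open>F\<close>. The coefficient 6 excludes a
      small fibre, which would give \<open>6 * card F \<le> 4 * card F\<close>; the remaining terms
      force at least a third of \<open>F\<close> to be satisfied.\<close>
    have "J A \<le> J ?B" using A by (intro Amin) (auto simp: \<A>_def)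
    then have key: "6 * card (F \<inter> small) + 3 * card uns \<le> 3 * card sat + card F"
      using bd cP sm unfolding J_def by linarith
    have Fne: "F \<noteq> {}" using r A by (auto simp: \<A>_def F_def)
    have large: "n < card F"
    proof (rule ccontr)
      assume "\<not> n < card F"
      then have "F \<inter> small = F" by (auto simp: F_def small_def)
      then have "6 * card F \<le> 4 * card F" using key cF by simp
      then show False using Fne finF by simp
    qed
    have "card F \<le> 3 * card sat" using key cF by linarith
    moreover have "sat = {x \<in> S. c x = r \<and> \<tau> x \<in> S \<and> c (\<tau> x) \<in> A}"
      by (auto simp: sat_def F_def P_def)
    ultimately show ?thesis using large by simp
  qed
  ultimately show thesis by (rule that)
qed

section \<open>Truncation levels and the passage from level sets to functions\<close>

lemma exists_truncation_level:
  fixes f :: "'x \<Rightarrow> real"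
  assumes Z: "finite Z"
  shows "\<exists>t\<ge>0. card {x \<in> Z. f x > t} \<le> n \<and> (t = 0 \<or> n < card {x \<in> Z. f x \<ge> t})"
proof -
  define T where "T = insert 0 (f ` {x \<in> Z. f x > 0})"
  define Q where "Q = {t \<in> T. card {x \<in> Z. f x > t} \<le> n}"
  have T: "finite T" "T \<noteq> {}" using Z by (auto simp: T_def)
  have "{x \<in> Z. f x > Max T} = {}"
  proof safe
    fix x assume x: "x \<in> Z" "Max T < f x"
    have "0 \<le> Max T" using T by (intro Max_ge) (auto simp: T_def)
    then have "f x \<in> T" using x by (auto simp: T_def)
    then have "f x \<le> Max T" using T by (intro Max_ge)
    then show "x \<in> {}" using x by simp
  qed
  then have "card {x \<in> Z. f x > Max T} \<le> n" by (simp only: card.empty)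
  then have "Max T \<in> Q" using Max_in[OF T] by (simp add: Q_def)
  then have Q: "finite Q" "Q \<noteq> {}" using T(1) unfolding Q_def by (auto simp only: finite_Collect_conjI Collect_mem_eq)
  \<comment> \<open>The \<open>(n + 1)\<close>-st largest positive value, or \<open>0\<close> if
    there are at most \<open>n\<close> positive values.\<close>
  define t where "t = Min Q"
  have t: "t \<in> Q" using Q by (simp add: t_def)
  have t0: "0 \<le> t" using t by (auto simp: Q_def T_def)
  have "n < card {x \<in> Z. f x \<ge> t}" if "t \<noteq> 0"
  proof -
    \<comment> \<open>The next lower candidate \<open>s\<close> has more than \<open>n\<close>
      values above it, and no value of \<open>f\<close> on \<open>Z\<close> lies strictly between
      \<open>s\<close> and \<open>t\<close>.\<close>
    define R where "R = {s \<in> T. s < t}"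
    have R: "finite R" "R \<noteq> {}" using T that t0 by (auto simp: R_def T_def)
    define s where "s = Max R"
    have s: "s \<in> R" using R by (simp add: s_def)
    have "s \<notin> Q" using s Q Min_le[of Q s] by (auto simp: R_def t_def)
    then have "n < card {x \<in> Z. f x > s}" using s by (auto simp: Q_def R_def)
    also have "{x \<in> Z. f x > s} \<subseteq> {x \<in> Z. f x \<ge> t}"
    proof safe
      fix x assume x: "x \<in> Z" "s < f x"
      have "0 \<le> s" using s by (auto simp: R_def T_def)
      then have "f x \<in> T" using x by (auto simp: T_def)
      then show "t \<le> f x" using x R Max_ge[of R "f x"] by (force simp: R_def s_def)
    qed
    then have "card {x \<in> Z. f x > s} \<le> card {x \<in> Z. f x \<ge> t}" using Z by (intro card_mono) auto
    finally show ?thesis .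
  qed
  then show ?thesis using t t0 by (auto simp: Q_def)
qed

text \<open>The index \<open>i\<close> is counted exactly for levels in a half-open interval of
  length \<open>max 0 (b i - a i)\<close>, so integrating the count over the level adds these
  lengths.\<close>

lemma layer_cake:
  fixes a b :: "'x \<Rightarrow> real"
  assumes "finite I"
  shows "integrable lborel (\<lambda>s. real (card {i \<in> I. a i \<le> s \<and> s < b i}))" (is ?thesis1)
    and "(LINT s|lborel. real (card {i \<in> I. a i \<le> s \<and> s < b i})) = (\<Sum>i\<in>I. max 0 (b i - a i))"
      (is ?thesis2)
proof -
  have int: "integrable lborel (\<lambda>s. indicator {u..<v} s :: real)" for u v :: real
    by (cases "u \<le> v") auto
  have eq: "(\<lambda>s. real (card {i \<in> I. a i \<le> s \<and> s < b i})) = (\<lambda>s. \<Sum>i\<in>I. indicator {a i..<b i} s)"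
    using assms by (simp add: fun_eq_iff indicator_def sum.If_cases Int_def)
  have "measure lborel {u..<v} = max 0 (v - u)" for u v :: real
    by (cases "u \<le> v") auto
  then have "(LINT s|lborel. (\<Sum>i\<in>I. indicator {a i..<b i} s)) = (\<Sum>i\<in>I. max 0 (b i - a i))"
    using int by (subst Bochner_Integration.integral_sum) auto
  then show ?thesis2 by (simp only: eq)
  show ?thesis1 unfolding eq using int by (intro Bochner_Integration.integrable_sum)
qed

text \<open>The set inequality is applied to each superlevel set of \<open>f ^ p\<close> and
  integrated over the level by \<open>layer_cake\<close>.\<close>

lemma functional_from_level_sets:
  fixes f :: "'x \<Rightarrow> real" and t :: "'r \<Rightarrow> real"
  assumes S: "finite S" and p: "p > 0"
    and f: "\<And>x. 0 \<le> f x" "\<And>x. x \<in> S \<Longrightarrow> \<tau> x \<notin> S \<Longrightarrow> f (\<tau> x) = 0"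
    and t: "\<And>r. 0 \<le> t r" "\<And>r. t r = 0 \<or> n < card {x \<in> S. c x = r \<and> t r \<le> f x}"
    and sets: "\<And>T. T \<subseteq> S \<Longrightarrow>
      card T \<le> 3 * card {x \<in> T. \<tau> x \<notin> T} + 6 * card {x \<in> T. card {y \<in> T. c y = c x} \<le> n}"
  shows "(\<Sum>x\<in>S. f x ^ p) \<le> 3 * (\<Sum>x\<in>S. max 0 (f x ^ p - f (\<tau> x) ^ p))
    + 6 * (\<Sum>x\<in>S. max 0 (f x ^ p - t (c x) ^ p))"
proof -
  let ?N = "\<lambda>a s. real (card {x \<in> S. a x \<le> s \<and> s < f x ^ p})"
  have pt: "?N (\<lambda>x. 0) s \<le> 3 * ?N (\<lambda>x. f (\<tau> x) ^ p) s + 6 * ?N (\<lambda>x. t (c x) ^ p) s" for s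
  proof (cases "0 \<le> s")
    case False
    then have "{x \<in> S. 0 \<le> s \<and> s < f x ^ p} = {}" by auto
    then show ?thesis by (simp only: card.empty of_nat_0)
  next
    case True
    define T where "T = {x \<in> S. s < f x ^ p}"
    \<comment> \<open>Where \<tau> leaves \<open>S\<close>, the value of \<open>f\<close> is
      \<open>0\<close>, which is at most the level.\<close>
    have 1: "{x \<in> T. \<tau> x \<notin> T} \<subseteq> {x \<in> S. f (\<tau> x) ^ p \<le> s \<and> s < f x ^ p}"
      using True p f(2) by (auto simp: T_def zero_power)
    have 2: "{x \<in> T. card {y \<in> T. c y = c x} \<le> n} \<subseteq> {x \<in> S. t (c x) ^ p \<le> s \<and> s < f x ^ p}"
    proof safe
      fix x assume x: "x \<in> T" "card {y \<in> T. c y = c x} \<le> n"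
      show "t (c x) ^ p \<le> s"
      proof (rule ccontr)
        \<comment> \<open>Below the truncation level the fibre in \<open>T\<close> contains all the
          more than \<open>n\<close> points with value at least \<open>t (c x)\<close>, so it is not
          small.\<close>
        assume "\<not> t (c x) ^ p \<le> s"
        then have less: "s < t (c x) ^ p" by simp
        then have "t (c x) \<noteq> 0" using True p by (auto simp: zero_power)
        then have "n < card {y \<in> S. c y = c x \<and> t (c x) \<le> f y}" using t(2) by blast
        also have "\<dots> \<le> card {y \<in> T. c y = c x}"
        proof (rule card_mono)
          show "{y \<in> S. c y = c x \<and> t (c x) \<le> f y} \<subseteq> {y \<in> T. c y = c x}"
            unfolding T_def using t(1) less by (auto intro: less_le_trans power_mono)
        qed (use S in \<open>simp add: T_def\<close>)
        finally show False using x(2) by simp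
      qed
    qed (auto simp: T_def)
    have "card T \<le> 3 * card {x \<in> T. \<tau> x \<notin> T} + 6 * card {x \<in> T. card {y \<in> T. c y = c x} \<le> n}"
      by (rule sets) (auto simp: T_def)
    also have "\<dots> \<le> 3 * card {x \<in> S. f (\<tau> x) ^ p \<le> s \<and> s < f x ^ p}
        + 6 * card {x \<in> S. t (c x) ^ p \<le> s \<and> s < f x ^ p}"
      using S by (intro add_mono mult_left_mono card_mono 1 2) auto
    also have "card T = card {x \<in> S. 0 \<le> s \<and> s < f x ^ p}" using True by (simp add: T_def)
    finally show ?thesis by linarith
  qed
  have "(LINT s|lborel. ?N (\<lambda>x. 0) s)
      \<le> (LINT s|lborel. 3 * ?N (\<lambda>x. f (\<tau> x) ^ p) s + 6 * ?N (\<lambda>x. t (c x) ^ p) s)"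
    using S pt by (intro integral_mono Bochner_Integration.integrable_add integrable_mult_right layer_cake(1)) auto
  also have "\<dots> = 3 * (LINT s|lborel. ?N (\<lambda>x. f (\<tau> x) ^ p) s) + 6 * (LINT s|lborel. ?N (\<lambda>x. t (c x) ^ p) s)"
    using S layer_cake(1) by (subst Bochner_Integration.integral_add) auto
  finally show ?thesis using S f(1) by (simp add: layer_cake(2))
qed

text \<open>\<open>powp_diff_le\<close> replaces both differences of powers by powers of
  differences; the parameter \<open>1 / 36\<close> is chosen so that the errors amount to half of
  the mass.\<close>

lemma functional_from_level_sets_diff:
  fixes f :: "'x \<Rightarrow> real" and t :: "'r \<Rightarrow> real"
  assumes S: "finite S" and p: "p = 1 \<or> p = 2"
    and inv: "\<And>x. x \<in> S \<Longrightarrow> \<tau> (\<tau> x) = x"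
    and f: "\<And>x. 0 \<le> f x" "\<And>x. x \<in> S \<Longrightarrow> \<tau> x \<notin> S \<Longrightarrow> f (\<tau> x) = 0"
    and t: "\<And>r. 0 \<le> t r" "\<And>r. t r = 0 \<or> n < card {x \<in> S. c x = r \<and> t r \<le> f x}"
    and sets: "\<And>T. T \<subseteq> S \<Longrightarrow>
      card T \<le> 3 * card {x \<in> T. \<tau> x \<notin> T} + 6 * card {x \<in> T. card {y \<in> T. c y = c x} \<le> n}"
  shows "(\<Sum>x\<in>S. f x ^ p) \<le> 432 * ((\<Sum>x\<in>S. \<bar>f (\<tau> x) - f x\<bar> ^ p)
    + (\<Sum>x\<in>S. max 0 (f x - t (c x)) ^ p))"
proof -
  have p0: "p > 0" using p by auto
  define M where "M = (\<Sum>x\<in>S. f x ^ p)"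
  define D where "D = (\<Sum>x\<in>S. \<bar>f (\<tau> x) - f x\<bar> ^ p)"
  define K where "K = (\<Sum>x\<in>S. max 0 (f x - t (c x)) ^ p)"
  \<comment> \<open>Images outside \<open>S\<close> contribute nothing, and \<tau> is injective on
    the points it keeps in \<open>S\<close>, so the partner values carry at most the mass
    \<open>M\<close>.\<close>
  have "(\<Sum>x\<in>S. f (\<tau> x) ^ p) = (\<Sum>x\<in>{x \<in> S. \<tau> x \<in> S}. f (\<tau> x) ^ p)"
    using S f(2) p0 by (intro sum.mono_neutral_right) auto
  also have "\<dots> = (\<Sum>x\<in>\<tau> ` {x \<in> S. \<tau> x \<in> S}. f x ^ p)"
    using inv by (subst sum.reindex) (auto intro: inj_on_inverseI[of _ \<tau>])
  also have "\<dots> \<le> M"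
    unfolding M_def using S f(1) by (intro sum_mono2) auto
  finally have M': "(\<Sum>x\<in>S. f (\<tau> x) ^ p) \<le> M" .
  have "max 0 (f x ^ p - f (\<tau> x) ^ p) \<le> 36 * \<bar>f (\<tau> x) - f x\<bar> ^ p + 1 / 36 * (f x ^ p + f (\<tau> x) ^ p)" for x
    using powp_diff_le[OF p, of "1 / 36" "f x" "f (\<tau> x)"] f(1)
    by (auto simp: abs_minus_commute intro!: max.boundedI add_nonneg_nonneg)
  then have "(\<Sum>x\<in>S. max 0 (f x ^ p - f (\<tau> x) ^ p))
      \<le> (\<Sum>x\<in>S. 36 * \<bar>f (\<tau> x) - f x\<bar> ^ p + 1 / 36 * (f x ^ p + f (\<tau> x) ^ p))"
    by (intro sum_mono)
  also have "\<dots> = 36 * D + 1 / 36 * (M + (\<Sum>x\<in>S. f (\<tau> x) ^ p))"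
    by (simp add: D_def M_def sum.distrib sum_distrib_left sum_divide_distrib[symmetric])
  finally have 1: "(\<Sum>x\<in>S. max 0 (f x ^ p - f (\<tau> x) ^ p)) \<le> 36 * D + 1 / 18 * M" using M' by argo
  have "max 0 (f x ^ p - t (c x) ^ p) \<le> 36 * max 0 (f x - t (c x)) ^ p + 1 / 18 * f x ^ p" for x
  proof (cases "t (c x) \<le> f x")
    case True
    then have "t (c x) ^ p \<le> f x ^ p" using t(1) by (intro power_mono)
    moreover have "f x ^ p - t (c x) ^ p \<le> 36 * \<bar>f x - t (c x)\<bar> ^ p + 1 / 36 * (f x ^ p + t (c x) ^ p)"
      using powp_diff_le[OF p, of "1 / 36" "f x" "t (c x)"] f(1) t(1) by simp
    moreover have "u - v \<le> 36 * w + 1 / 18 * u" if "v \<le> u" "u - v \<le> 36 * w + 1 / 36 * (u + v)"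
      for u v w :: real using that by argo
    ultimately have "f x ^ p - t (c x) ^ p \<le> 36 * \<bar>f x - t (c x)\<bar> ^ p + 1 / 18 * f x ^ p"
      by blast
    then show ?thesis using True \<open>t (c x) ^ p \<le> f x ^ p\<close> by (simp add: max_def)
  next
    case False
    then have "f x ^ p \<le> t (c x) ^ p" using f(1) by (intro power_mono) auto
    then show ?thesis using f(1)[of x] by (simp add: max_def)
  qed
  then have "(\<Sum>x\<in>S. max 0 (f x ^ p - t (c x) ^ p))
      \<le> (\<Sum>x\<in>S. 36 * max 0 (f x - t (c x)) ^ p + 1 / 18 * f x ^ p)"
    by (intro sum_mono)
  also have "\<dots> = 36 * K + 1 / 18 * M"
    by (simp add: K_def M_def sum.distrib sum_distrib_left sum_divide_distrib[symmetric])
  finally have 2: "(\<Sum>x\<in>S. max 0 (f x ^ p - t (c x) ^ p)) \<le> 36 * K + 1 / 18 * M" .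
  have D0: "0 \<le> D" unfolding D_def by (intro sum_nonneg) auto
  have "M \<le> 3 * (\<Sum>x\<in>S. max 0 (f x ^ p - f (\<tau> x) ^ p)) + 6 * (\<Sum>x\<in>S. max 0 (f x ^ p - t (c x) ^ p))"
    unfolding M_def by (rule functional_from_level_sets[OF S p0 f t sets])
  \<comment> \<open>The errors \<open>3 / 18 + 6 / 18 = 1 / 2\<close> of \<open>M\<close> move to
    the left side; doubling the larger coefficient \<open>6 * 36\<close> gives
    \<open>432\<close>.\<close>
  then have "M \<le> 432 * (D + K)" using 1 2 D0 by (simp add: algebra_simps)
  then show ?thesis by (simp add: M_def D_def K_def)
qed

section \<open>Numerical estimates\<close>

text \<open>Here \<open>L\<close> stands for \<open>ln (1 + v)\<close>. The square-root bound makes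
  the logarithm of a suitable multiple of the ratio at least of order
  \<open>ln (1 + L)\<close>.\<close>

lemma volume_ratio_bounds:
  fixes L :: real
  assumes "0 < L"
  shows "1 \<le> L / ln (1 + L)" "L / ln (1 + L) \<le> 1 + L" "sqrt (1 + L) / 2 \<le> L / ln (1 + L)"
proof -
  have l: "0 < ln (1 + L)" using assms by simp
  show "1 \<le> L / ln (1 + L)" using l assms ln_add_one_self_le_self[of L] by (simp add: field_simps)
  have "1 - 1 / (1 + L) \<le> ln (1 + L)"
    using assms ln_le_minus_one[of "1 / (1 + L)"] by (simp add: ln_div)
  then have "L \<le> (1 + L) * ln (1 + L)" using assms by (simp add: field_simps)
  then show "L / ln (1 + L) \<le> 1 + L" using l by (simp add: divide_le_eq)
  define q where "q = sqrt (1 + L)"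
  have q: "1 < q" "L = q * q - 1" using assms by (auto simp: q_def)
  have "ln (1 + L) = 2 * ln q" using q by (simp add: ln_mult)
  also have "\<dots> \<le> 2 * (q - 1)" using q ln_le_minus_one[of q] by simp
  finally have "q / 2 * ln (1 + L) \<le> q / 2 * (2 * (q - 1))"
    using q by (intro mult_left_mono) auto
  also have "\<dots> \<le> L" using q by (simp add: algebra_simps)
  finally show "sqrt (1 + L) / 2 \<le> L / ln (1 + L)" using l by (simp add: le_divide_eq q_def)
qed

text \<open>The last \<open>j\<close> factors of the factorial all exceed \<open>j\<close>; the
  induction runs over their number.\<close>

lemma power_self_le_fact_double: "j ^ j \<le> (fact (2 * j) :: nat)"
proof -
  have "j ^ k \<le> (fact (j + k) :: nat)" for k
  proof (induction k)
    case (Suc k)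
    have "j * j ^ k \<le> (j + Suc k) * fact (j + k)" using Suc by (intro mult_mono) auto
    then show ?case by (simp add: algebra_simps)
  qed (simp add: Suc_leI)
  then show ?thesis by (simp add: mult_2)
qed

text \<open>A crude form of Stirling: for \<open>j\<close> about four times the ratio,
  \<open>j * ln j\<close> exceeds \<open>L\<close>, so \<open>j ^ j\<close> exceeds
  \<open>1 + v\<close>, and \<open>fact (2 * j)\<close> is at least as large.\<close>

lemma exists_fact_gt:
  fixes v :: real
  assumes v: "1 \<le> v"
  shows "\<exists>k::nat. 1 \<le> k \<and> v < fact (k + 1) \<and> real (3 * k) \<le> 30 * (ln (1 + v) / ln (1 + ln (1 + v)))"
proof -
  define L where "L = ln (1 + v)"
  define r where "r = L / ln (1 + L)"
  have L: "0 < L" using v by (simp add: L_def)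
  have r: "1 \<le> r" "sqrt (1 + L) / 2 \<le> r" using volume_ratio_bounds[OF L] by (auto simp: r_def)
  \<comment> \<open>With the factor 4, \<open>ln j\<close> is at least half of
    \<open>ln (1 + L)\<close> and \<open>j * ln j\<close> is at least \<open>2 * L\<close>, which is
    strictly above \<open>L\<close>.\<close>
  define j where "j = nat \<lceil>4 * r\<rceil>"
  have j: "4 * r \<le> real j" "real j \<le> 4 * r + 1" unfolding j_def using r by linarith+
  have "sqrt (1 + L) \<le> real j" using j r by simp
  then have "ln (sqrt (1 + L)) \<le> ln (real j)" using L by (intro ln_mono) auto
  then have lnj: "ln (1 + L) / 2 \<le> ln (real j)" using L by (simp add: ln_sqrt)
  have "2 * L = 4 * r * (ln (1 + L) / 2)" using L by (simp add: r_def)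
  also have "\<dots> \<le> real j * ln (real j)" using j lnj L r by (intro mult_mono) auto
  finally have "L < real j * ln (real j)" using L by simp
  then have "L < ln (real j ^ j)" using j r by (simp add: ln_realpow)
  then have "1 + v < real j ^ j" using v j r by (simp add: L_def)
  also have "real j ^ j \<le> fact (2 * j)"
    using power_self_le_fact_double[of j] by (metis of_nat_fact of_nat_le_iff of_nat_power)
  finally have vf: "v < fact (2 * j)" by simp
  have "1 \<le> j" using j r by linarith
  \<comment> \<open>The witness \<open>k = 2 * j - 1\<close> gives \<open>k + 1 = 2 * j\<close>, and
    \<open>3 * k \<le> 24 * r + 3\<close> stays below \<open>30 * r\<close> because
    \<open>1 \<le> r\<close>.\<close>
  then have "2 * j - 1 + 1 = 2 * j" "1 \<le> 2 * j - 1" by auto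
  moreover have "real (3 * (2 * j - 1)) \<le> 30 * r" using j r \<open>1 \<le> j\<close> by (simp add: of_nat_diff)
  ultimately show ?thesis using vf unfolding r_def L_def by (intro exI[of _ "2 * j - 1"]) metis
qed

text \<open>With \<open>N = n + 1\<close> the left side is at most \<open>Q = N ^ (n + 1)\<close>,
  whose logarithm is at most \<open>L / 2\<close>. Thus even the square of \<open>Q\<close> is at
  most \<open>1 + v\<close>, which leaves room to replace \<open>1 + v\<close> by
  \<open>v\<close>.\<close>

lemma fact_le_of_le_volume_ratio:
  fixes v :: real and n :: nat
  assumes v: "0 < v" and n: "1 \<le> n" and le: "real n \<le> 1 / 4 * (ln (1 + v) / ln (1 + ln (1 + v)))"
  shows "real n * fact (n + 1) \<le> v"
proof -
  define L where "L = ln (1 + v)"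
  define r where "r = L / ln (1 + L)"
  have L: "0 < L" using v by (simp add: L_def)
  have r: "r \<le> 1 + L" "0 < r" "4 * real n \<le> r"
    using volume_ratio_bounds[OF L] le by (auto simp: r_def L_def)
  define N where "N = real (n + 1)"
  have N: "2 \<le> N" "2 * N \<le> r" using n r by (auto simp: N_def)
  have "N * ln N \<le> (r / 2) * ln (1 + L)"
    using N r by (intro mult_mono ln_mono) auto
  also have "\<dots> = L / 2" using L by (simp add: r_def)
  finally have NL: "2 * ln (N ^ (n + 1)) \<le> L" using N unfolding ln_realpow[of N "n + 1"] by (simp add: N_def algebra_simps)
  define Q where "Q = N ^ (n + 1)"
  have "2 ^ 2 \<le> N ^ 2" using N by (intro power_mono) auto
  also have "\<dots> \<le> Q" unfolding Q_def using N n by (intro power_increasing) auto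
  finally have Q: "4 \<le> Q" by simp
  have "ln (Q\<^sup>2) \<le> ln (1 + v)" using NL Q by (simp only: Q_def[symmetric] L_def ln_realpow)
  then have "Q\<^sup>2 \<le> 1 + v" using Q v by simp
  moreover have "4 * Q \<le> Q\<^sup>2" using Q by (simp add: power2_eq_square)
  ultimately have Qv: "Q \<le> v" using Q by linarith
  have "fact (Suc k) \<le> real (Suc k) ^ k" for k
  proof (induction k)
    case (Suc k)
    have "fact (Suc (Suc k)) = real (Suc (Suc k)) * fact (Suc k)" by simp
    also have "\<dots> \<le> real (Suc (Suc k)) * real (Suc (Suc k)) ^ k"
      using Suc by (intro mult_left_mono order_trans[OF Suc] power_mono) auto
    finally show ?case by simp
  qed simp
  from this[of n] have "real n * fact (n + 1) \<le> N * N ^ n"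
    by (intro mult_mono) (auto simp: N_def)
  then show ?thesis using Qv by (simp add: Q_def)
qed

section \<open>Coordinates on the pocket extension\<close>

locale infinite_group = group G for G (structure) +
  assumes infinite_carrier: "infinite (carrier G)"
begin

abbreviation "X \<equiv> pocket_points G"
abbreviation "P \<equiv> pocket_extension G"
abbreviation "tr \<equiv> pocket_translation G"
abbreviation "\<tau> \<equiv> pocket_transposition G"

sublocale P: group P by (rule group_pocket_extension)
sublocale tr: group_hom G "BijGroup X" tr by (rule group_hom_pocket_translation[OF is_group])

declare tr.hom_one [simp del] tr.hom_mult [simp del] tr.hom_inv [simp del]

section \<open>Generators and multiplication of the pocket extension as maps on points\<close>

lemma pocket_generators_in_Bij: "insert \<tau> (tr ` carrier G) \<subseteq> carrier (BijGroup X)"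
  using pocket_transposition_in_Bij[OF is_group] pocket_translation_in_Bij[OF is_group] by auto

lemma carrier_pocket_extension:
  "carrier P = generate (BijGroup X) (insert \<tau> (tr ` carrier G))"
  using pocket_generators_in_Bij
  by (simp add: pocket_extension_def subgroup_generated_def Int_absorb1)

lemma generate_pocket_extension: "generate P (insert \<tau> (tr ` carrier G)) = carrier P"
proof -
  let ?U = "insert \<tau> (tr ` carrier G)"
  have "generate (BijGroup X \<lparr>carrier := generate (BijGroup X) ?U\<rparr>) ?U = generate (BijGroup X) ?U"
    by (rule tr.H.generate_consistent[OF _ tr.H.generate_is_subgroup[OF pocket_generators_in_Bij]])
       (auto intro: generate.incl)
  moreover have "P = BijGroup X \<lparr>carrier := generate (BijGroup X) ?U\<rparr>"
    using pocket_generators_in_Bij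
    by (simp add: pocket_extension_def subgroup_generated_def Int_absorb1)
  ultimately show ?thesis by (simp add: carrier_pocket_extension)
qed

lemma transposition_in_carrier: "\<tau> \<in> carrier P"
  by (simp add: carrier_pocket_extension generate.incl)

lemma translation_in_carrier: "g \<in> carrier G \<Longrightarrow> tr g \<in> carrier P"
  by (simp add: carrier_pocket_extension generate.incl)

lemma carrier_in_Bij: "x \<in> carrier P \<Longrightarrow> x \<in> Bij X"
  using tr.H.generate_in_carrier[OF pocket_generators_in_Bij, of x]
  unfolding carrier_pocket_extension by (simp add: BijGroup_def)

lemma bij_betw_of_carrier: "x \<in> carrier P \<Longrightarrow> bij_betw x X X"
  using carrier_in_Bij by (simp add: Bij_def)

lemma carrier_in_points: "x \<in> carrier P \<Longrightarrow> l \<in> X \<Longrightarrow> x l \<in> X"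
  using bij_betw_of_carrier by (auto simp: bij_betw_def)

lemma pocket_ext:
  assumes "x \<in> carrier P" "y \<in> carrier P" "\<And>l. l \<in> X \<Longrightarrow> x l = y l"
  shows "x = y"
  using assms carrier_in_Bij by (intro extensionalityI[of _ X]) (auto simp: Bij_def)

lemma mult_pocket_extension: "x \<otimes>\<^bsub>P\<^esub> y = x \<otimes>\<^bsub>BijGroup X\<^esub> y"
  by (simp add: pocket_extension_def subgroup_generated_def)

lemma mult_apply:
  assumes "x \<in> carrier P" "y \<in> carrier P" "l \<in> X"
  shows "(x \<otimes>\<^bsub>P\<^esub> y) l = x (y l)"
  using assms carrier_in_Bij[OF assms(1)] carrier_in_Bij[OF assms(2)]
  unfolding mult_pocket_extension by (simp add: BijGroup_def compose_def)

lemma translation_apply: "l \<in> X \<Longrightarrow> tr g l = map_option (\<lambda>k. g \<otimes> k) l"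
  by (simp add: pocket_translation_def)

lemma transposition_apply: "l \<in> X \<Longrightarrow> \<tau> l = Transposition.transpose None (Some \<one>) l"
  by (simp add: pocket_transposition_def)

lemma translation_mult:
  "g \<in> carrier G \<Longrightarrow> h \<in> carrier G \<Longrightarrow> tr g \<otimes>\<^bsub>P\<^esub> tr h = tr (g \<otimes> h)"
  by (simp add: mult_pocket_extension tr.hom_mult)

lemma translation_one: "tr \<one> = \<one>\<^bsub>P\<^esub>"
  by (simp add: pocket_extension_def subgroup_generated_def tr.hom_one)

lemma transposition_mult_self: "\<tau> \<otimes>\<^bsub>P\<^esub> \<tau> = \<one>\<^bsub>P\<^esub>"
proof -
  have "(\<tau> \<otimes>\<^bsub>P\<^esub> \<tau>) l = (\<one>\<^bsub>P\<^esub>) l" if l: "l \<in> X" for l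
  proof -
    have "\<tau> l \<in> X" by (rule carrier_in_points[OF transposition_in_carrier l])
    moreover have "(\<one>\<^bsub>P\<^esub>) l = l" using l
      by (auto simp: translation_one[symmetric] translation_apply pocket_points_def)
    ultimately show ?thesis using l transposition_in_carrier
      by (simp add: mult_apply transposition_apply)
  qed
  then show ?thesis using transposition_in_carrier by (intro pocket_ext) auto
qed

lemma transposition_twice:
  assumes "x \<in> carrier P"
  shows "\<tau> \<otimes>\<^bsub>P\<^esub> (\<tau> \<otimes>\<^bsub>P\<^esub> x) = x"
  using assms transposition_in_carrier
  by (simp add: P.m_assoc[symmetric] transposition_mult_self)

text \<open>\<open>drift\<close> and \<open>perm_part\<close> are the two coordinates in the semidirect product of the finitary
  permutations with \<open>G\<close>.\<close>

definition drifts :: "('a option \<Rightarrow> 'a option) \<Rightarrow> 'a \<Rightarrow> bool" where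
  "drifts x g \<longleftrightarrow> g \<in> carrier G \<and> finite {l \<in> X. x l \<noteq> tr g l}"

definition drift :: "('a option \<Rightarrow> 'a option) \<Rightarrow> 'a" where
  "drift x = (THE g. drifts x g)"

definition perm_part :: "('a option \<Rightarrow> 'a option) \<Rightarrow> 'a option \<Rightarrow> 'a option" where
  "perm_part x = tr (inv (drift x)) \<otimes>\<^bsub>P\<^esub> x"

lemma drifts_translation: "g \<in> carrier G \<Longrightarrow> drifts (tr g) g"
  by (simp add: drifts_def)

lemma drifts_transposition: "drifts \<tau> \<one>"
proof -
  have "{l \<in> X. \<tau> l \<noteq> tr \<one> l} \<subseteq> {None, Some \<one>}"
    by (auto simp: transposition_apply translation_apply pocket_points_def Transposition.transpose_def
        split: if_splits)
  then have "finite {l \<in> X. \<tau> l \<noteq> tr \<one> l}" by (rule finite_subset) simp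
  then show ?thesis by (simp add: drifts_def)
qed

text \<open>A point is exceptional for the product only if it is exceptional for \<open>y\<close> or
  if its image under \<open>tr h\<close> is exceptional for \<open>x\<close>. As \<open>tr h\<close>
  is injective, both sets are finite.\<close>

lemma drifts_mult:
  assumes x: "x \<in> carrier P" "drifts x g" and y: "y \<in> carrier P" "drifts y h"
  shows "drifts (x \<otimes>\<^bsub>P\<^esub> y) (g \<otimes> h)"
proof -
  have gh: "g \<in> carrier G" "h \<in> carrier G" using x y by (auto simp: drifts_def)
  have sub: "{l \<in> X. (x \<otimes>\<^bsub>P\<^esub> y) l \<noteq> tr (g \<otimes> h) l}
    \<subseteq> {l \<in> X. y l \<noteq> tr h l} \<union> (tr h -` {l \<in> X. x l \<noteq> tr g l} \<inter> X)"
  proof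
    fix l assume "l \<in> {l \<in> X. (x \<otimes>\<^bsub>P\<^esub> y) l \<noteq> tr (g \<otimes> h) l}"
    then have l: "l \<in> X" "x (y l) \<noteq> tr (g \<otimes> h) l" using x y by (auto simp: mult_apply)
    have "tr (g \<otimes> h) l = tr g (tr h l)"
      using l(1) gh by (simp add: translation_mult[symmetric] mult_apply translation_in_carrier)
    moreover have "tr h l \<in> X" by (rule carrier_in_points[OF translation_in_carrier[OF gh(2)] l(1)])
    ultimately show "l \<in> {l \<in> X. y l \<noteq> tr h l} \<union> (tr h -` {l \<in> X. x l \<noteq> tr g l} \<inter> X)"
      using l by auto
  qed
  have "inj_on (tr h) X"
    using bij_betw_of_carrier[OF translation_in_carrier[OF gh(2)]] by (simp add: bij_betw_def)
  then have "finite (tr h -` {l \<in> X. x l \<noteq> tr g l} \<inter> X)"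
    using x by (intro finite_vimage_IntI) (simp_all add: drifts_def)
  then have "finite {l \<in> X. (x \<otimes>\<^bsub>P\<^esub> y) l \<noteq> tr (g \<otimes> h) l}"
    using y by (intro finite_subset[OF sub]) (simp add: drifts_def)
  then show ?thesis using gh by (simp add: drifts_def)
qed

text \<open>Finite deviation from a translation holds for the generators and survives products.
  Inverses occur only for generators, and there the transposition is its own inverse.\<close>

lemma drifts_exists:
  assumes "x \<in> carrier P"
  shows "\<exists>g. drifts x g"
proof -
  have tt: "inv\<^bsub>BijGroup X\<^esub> \<tau> = \<tau>"
  proof (rule tr.H.inv_equality)
    show "\<tau> \<otimes>\<^bsub>BijGroup X\<^esub> \<tau> = \<one>\<^bsub>BijGroup X\<^esub>"
      using transposition_mult_self
      by (simp add: mult_pocket_extension translation_one[symmetric] tr.hom_one)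
  qed (use pocket_generators_in_Bij in auto)
  have "x \<in> carrier P \<and> (\<exists>g. drifts x g)"
    using assms unfolding carrier_pocket_extension
  proof induction
    case one
    have "drifts \<one>\<^bsub>BijGroup X\<^esub> \<one>" using drifts_translation[of \<one>] by (simp add: tr.hom_one)
    then show ?case using generate.one by blast
  next
    case (incl h)
    then have "\<exists>g. drifts h g"
      using drifts_translation drifts_transposition by auto
    then show ?case using generate.incl[OF incl] by blast
  next
    case (inv h)
    then consider "h = \<tau>" | k where "k \<in> carrier G" "h = tr k" by auto
    then have "\<exists>g. drifts (inv\<^bsub>BijGroup X\<^esub> h) g"
    proof cases
      case 1
      then show ?thesis using tt drifts_transposition by auto
    next
      case 2
      then have "inv\<^bsub>BijGroup X\<^esub> h = tr (inv k)" by (simp add: tr.hom_inv)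
      then show ?thesis using drifts_translation[of "inv k"] 2 by auto
    qed
    then show ?case using generate.inv[OF inv] by blast
  next
    case (eng a b)
    obtain g h where gh: "drifts a g" "drifts b h" using eng.IH by blast
    have "drifts (a \<otimes>\<^bsub>BijGroup X\<^esub> b) (g \<otimes> h)"
      using drifts_mult[OF _ gh(1) _ gh(2)] eng.hyps
      by (simp add: carrier_pocket_extension mult_pocket_extension)
    then show ?case using generate.eng[OF eng.hyps] by blast
  qed
  then show ?thesis by simp
qed

text \<open>Distinct translations disagree at every point of \<open>G\<close>, so one of the two
  exceptional sets would be infinite. Infiniteness of \<open>G\<close> enters here.\<close>

lemma drifts_unique:
  assumes "drifts x g" "drifts x h"
  shows "g = h"
proof (rule ccontr)
  assume ne: "g \<noteq> h"
  have gh: "g \<in> carrier G" "h \<in> carrier G" using assms by (auto simp: drifts_def)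
  have "Some ` carrier G \<subseteq> {l \<in> X. x l \<noteq> tr g l} \<union> {l \<in> X. x l \<noteq> tr h l}"
    using ne gh by (auto simp: translation_apply pocket_points_def)
  then have "finite (Some ` carrier G)"
    by (rule finite_subset) (use assms in \<open>simp add: drifts_def\<close>)
  then show False using infinite_carrier by (simp add: finite_image_iff)
qed

lemma drift_eqI: "drifts x g \<Longrightarrow> drift x = g"
  unfolding drift_def using drifts_unique by blast

lemma drifts_drift: "x \<in> carrier P \<Longrightarrow> drifts x (drift x)"
  using drifts_exists drift_eqI by metis

lemma drift_closed: "x \<in> carrier P \<Longrightarrow> drift x \<in> carrier G"
  using drifts_drift by (simp add: drifts_def)

lemma drift_translation_mult:
  assumes "g \<in> carrier G" "x \<in> carrier P"
  shows "drift (tr g \<otimes>\<^bsub>P\<^esub> x) = g \<otimes> drift x"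
  using assms by (intro drift_eqI drifts_mult translation_in_carrier drifts_translation drifts_drift)

lemma drift_transposition_mult:
  assumes "x \<in> carrier P"
  shows "drift (\<tau> \<otimes>\<^bsub>P\<^esub> x) = drift x"
  using drifts_mult[OF transposition_in_carrier drifts_transposition assms drifts_drift[OF assms]]
  by (intro drift_eqI) (simp add: drift_closed assms)

lemma perm_part_closed: "x \<in> carrier P \<Longrightarrow> perm_part x \<in> carrier P"
  by (simp add: perm_part_def translation_in_carrier drift_closed)

lemma drift_perm_part: "x \<in> carrier P \<Longrightarrow> drift (perm_part x) = \<one>"
  by (simp add: perm_part_def drift_translation_mult drift_closed)

lemma perm_part_translation_mult:
  assumes "g \<in> carrier G" "x \<in> carrier P"
  shows "perm_part (tr g \<otimes>\<^bsub>P\<^esub> x) = perm_part x"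
proof -
  have d: "drift x \<in> carrier G" using assms by (simp add: drift_closed)
  have "inv (g \<otimes> drift x) \<otimes> g = inv (drift x)"
    using assms d by (simp add: inv_mult_group m_assoc)
  then show ?thesis
    using assms d by (simp add: perm_part_def drift_translation_mult P.m_assoc[symmetric]
        translation_in_carrier translation_mult)
qed

lemma translation_perm_part:
  assumes "x \<in> carrier P"
  shows "tr (drift x) \<otimes>\<^bsub>P\<^esub> perm_part x = x"
  using assms by (simp add: perm_part_def P.m_assoc[symmetric] translation_in_carrier
      translation_mult drift_closed translation_one)

lemma perm_part_eq_self: "x \<in> carrier P \<Longrightarrow> drift x = \<one> \<Longrightarrow> perm_part x = x"
  by (simp add: perm_part_def translation_one)

text \<open>The drift is unchanged, and conjugating the transposition of \<open>None\<close> and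
  \<open>Some \<one>\<close> by the translation by \<open>inv (drift x)\<close> moves its second
  point to \<open>Some (inv (drift x))\<close>.\<close>

lemma perm_part_transposition_mult:
  assumes x: "x \<in> carrier P" and l: "l \<in> X"
  shows "perm_part (\<tau> \<otimes>\<^bsub>P\<^esub> x) l
    = Transposition.transpose None (Some (inv (drift x))) (perm_part x l)"
proof -
  define g where "g = inv (drift x)"
  have g: "g \<in> carrier G" using x by (simp add: g_def drift_closed)
  define m where "m = x l"
  have m: "m \<in> X" "\<tau> m \<in> X"
    using x l carrier_in_points transposition_in_carrier by (auto simp: m_def)
  have 1: "perm_part (\<tau> \<otimes>\<^bsub>P\<^esub> x) l = tr g (\<tau> m)"
    using x l transposition_in_carrier g
    by (simp add: perm_part_def drift_transposition_mult g_def[symmetric] m_def mult_apply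
        translation_in_carrier)
  have 2: "perm_part x l = tr g m"
    using x l g by (simp add: perm_part_def g_def[symmetric] m_def mult_apply translation_in_carrier)
  have "tr g (\<tau> m) = Transposition.transpose None (Some g) (tr g m)"
    using m g by (auto simp: transposition_apply translation_apply pocket_points_def
        Transposition.transpose_def)
  then show ?thesis using 1 2 by (simp add: g_def)
qed

text \<open>Otherwise \<open>exists_satisfied_fibres\<close> with threshold \<open>3 * k\<close>
  yields a set of permutations, each with at least \<open>k + 1\<close> star neighbours in the set;
  by \<open>star_graph_card_ge_fact\<close> it is too large to come from \<open>T\<close>.\<close>

lemma level_set_inequality:
  assumes T: "T \<subseteq> carrier P" "finite T" and small: "card T < fact (k + 1)"
  shows "card T \<le> 3 * card {x \<in> T. \<tau> \<otimes>\<^bsub>P\<^esub> x \<notin> T}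
    + 6 * card {x \<in> T. card {y \<in> T. perm_part y = perm_part x} \<le> 3 * k}"
proof (rule ccontr)
  assume "\<not> ?thesis"
  then have "3 * card {x \<in> T. \<tau> \<otimes>\<^bsub>P\<^esub> x \<notin> T}
    + 6 * card {x \<in> T. card {y \<in> T. perm_part y = perm_part x} \<le> 3 * k} < card T" by simp
  moreover have "\<tau> \<otimes>\<^bsub>P\<^esub> (\<tau> \<otimes>\<^bsub>P\<^esub> x) = x" if "x \<in> T" for x
    using that T(1) by (intro transposition_twice) auto
  ultimately obtain A where A: "A \<noteq> {}" "A \<subseteq> perm_part ` T"
    "\<And>r. r \<in> A \<Longrightarrow> 3 * k < 3 * card {x \<in> T. perm_part x = r \<and> \<tau> \<otimes>\<^bsub>P\<^esub> x \<in> T \<and>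
        perm_part (\<tau> \<otimes>\<^bsub>P\<^esub> x) \<in> A}"
    using exists_satisfied_fibres[OF T(2), of "\<lambda>x. \<tau> \<otimes>\<^bsub>P\<^esub> x" perm_part "3 * k"] by blast
  have finA: "finite A" using A(2) T(2) finite_surj by blast
  have "fact (k + 1) \<le> card A"
  proof (rule star_graph_card_ge_fact[OF finA A(1), where b = None and X = X])
    fix r assume r: "r \<in> A"
    then have "r \<in> carrier P" using A(2) T(1) perm_part_closed by blast
    then have "r ` X = X" using bij_betw_of_carrier by (simp add: bij_betw_def)
    moreover have "None \<in> X" by (simp add: pocket_points_def)
    ultimately show "\<exists>l\<in>X. r l = None" by (metis imageE)
    define E where "E = {x \<in> T. perm_part x = r \<and> \<tau> \<otimes>\<^bsub>P\<^esub> x \<in> T \<and> perm_part (\<tau> \<otimes>\<^bsub>P\<^esub> x) \<in> A}"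
    let ?u = "\<lambda>x. Some (inv (drift x))"
    show "\<exists>U. finite U \<and> k + 1 \<le> card U \<and> None \<notin> U \<and>
      (\<forall>u\<in>U. \<exists>\<sigma>'\<in>A. \<forall>l\<in>X. \<sigma>' l = Transposition.transpose None u (r l))"
    proof (intro exI[of _ "?u ` E"] conjI ballI)
      \<comment> \<open>Within one fibre the drift determines the point, so distinct satisfied
        points give distinct transpositions; \<open>3 * k < 3 * card E\<close> provides
        \<open>k + 1\<close> of them.\<close>
      have "inj_on ?u E"
      proof (rule inj_onI)
        fix x y assume xy: "x \<in> E" "y \<in> E" "?u x = ?u y"
        then have c: "x \<in> carrier P" "y \<in> carrier P" "perm_part x = perm_part y"
          using T(1) by (auto simp: E_def)
        then have "drift x = drift y" using xy(3) drift_closed by (metis option.inject inv_inv)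
        then show "x = y" using c translation_perm_part by metis
      qed
      then show "k + 1 \<le> card (?u ` E)"
        using A(3)[OF r] by (simp add: card_image E_def)
    next
      fix u assume "u \<in> ?u ` E"
      then obtain x where x: "x \<in> E" "u = ?u x" by blast
      then show "\<exists>\<sigma>'\<in>A. \<forall>l\<in>X. \<sigma>' l = Transposition.transpose None u (r l)"
        using T(1) perm_part_transposition_mult
        by (intro bexI[of _ "perm_part (\<tau> \<otimes>\<^bsub>P\<^esub> x)"]) (auto simp: E_def)
    qed (use T(2) in \<open>auto simp: E_def\<close>)
  qed
  also have "card A \<le> card T" using A(2) T(2) by (meson card_image_le card_mono finite_imageI le_trans)
  finally show False using small by simp
qed

section \<open>Lower bound\<close>

lemma translation_mult_assoc:
  assumes "h \<in> carrier G" "g \<in> carrier G" "r \<in> carrier P"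
  shows "tr h \<otimes>\<^bsub>P\<^esub> (tr g \<otimes>\<^bsub>P\<^esub> r) = tr (h \<otimes> g) \<otimes>\<^bsub>P\<^esub> r"
  using assms by (simp add: P.m_assoc[symmetric] translation_in_carrier translation_mult)

abbreviation finitary :: "('a option \<Rightarrow> 'a option) set" where
  "finitary \<equiv> {y \<in> carrier P. drift y = \<one>}"

lemma perm_part_finitary: "x \<in> carrier P \<Longrightarrow> perm_part x \<in> finitary"
  by (simp add: perm_part_closed drift_perm_part)

lemma drift_translation_finitary: "g \<in> carrier G \<Longrightarrow> y \<in> finitary \<Longrightarrow> drift (tr g \<otimes>\<^bsub>P\<^esub> y) = g"
  by (simp add: drift_translation_mult)

lemma perm_part_translation_finitary:
  "g \<in> carrier G \<Longrightarrow> y \<in> finitary \<Longrightarrow> perm_part (tr g \<otimes>\<^bsub>P\<^esub> y) = y"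
  by (simp add: perm_part_translation_mult perm_part_eq_self)

lemma inj_on_semidirect: "inj_on (\<lambda>(y, g). tr g \<otimes>\<^bsub>P\<^esub> y) (finitary \<times> carrier G)"
  by (rule inj_on_inverseI[where g = "\<lambda>x. (perm_part x, drift x)"])
     (auto simp: drift_translation_mult perm_part_translation_mult perm_part_eq_self)

text \<open>Left translations preserve the permutation part, so the fibres contribute disjoint
  pieces to the dispersion of \<open>F\<close>. A 1-Lipschitz \<open>\<theta> r\<close>, possibly
  different on each fibre, only shrinks differences.\<close>

lemma sum_fibre_disp_le:
  assumes F: "finite (supp_on P F)" and R: "finite R" "R \<subseteq> finitary" and h: "h \<in> carrier G"
    and lip: "\<And>r a b. \<bar>\<theta> r a - \<theta> r b\<bar> \<le> \<bar>a - b :: real\<bar>"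
  shows "(\<Sum>r\<in>R. disp G p (\<lambda>g. \<theta> r (F (tr g \<otimes>\<^bsub>P\<^esub> r))) h) \<le> disp P p F (tr h)"
proof -
  define e where "e = (\<lambda>(y, g). tr g \<otimes>\<^bsub>P\<^esub> y)"
  define Z where "Z r = {g \<in> carrier G. \<theta> r (F (tr (h \<otimes> g) \<otimes>\<^bsub>P\<^esub> r)) \<noteq> \<theta> r (F (tr g \<otimes>\<^bsub>P\<^esub> r))}" for r
  define W where "W = {x \<in> carrier P. F (tr h \<otimes>\<^bsub>P\<^esub> x) \<noteq> F x}"
  have W: "finite W"
    unfolding W_def using P.finite_disp_support[OF F translation_in_carrier[OF h]] .
  have inj: "inj_on e (Sigma R Z)"
    unfolding e_def by (rule inj_on_subset[OF inj_on_semidirect]) (use R in \<open>auto simp: Z_def\<close>)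
  have sub: "e ` Sigma R Z \<subseteq> W"
  proof clarify
    fix r g assume rg: "r \<in> R" "g \<in> Z r"
    then have c: "r \<in> carrier P" "g \<in> carrier G" using R by (auto simp: Z_def)
    show "e (r, g) \<in> W"
      using rg c h by (auto simp: W_def e_def Z_def translation_mult_assoc translation_in_carrier)
  qed
  have finZ: "finite (Sigma R Z)" using inj sub W by (meson finite_imageD finite_subset)
  have finZr: "finite (Z r)" if "r \<in> R" for r
  proof -
    have "Z r \<subseteq> snd ` Sigma R Z" using that by force
    then show ?thesis using finZ finite_subset by blast
  qed
  have "(\<Sum>r\<in>R. disp G p (\<lambda>g. \<theta> r (F (tr g \<otimes>\<^bsub>P\<^esub> r))) h)
    = (\<Sum>r\<in>R. \<Sum>g\<in>Z r. \<bar>\<theta> r (F (tr (h \<otimes> g) \<otimes>\<^bsub>P\<^esub> r)) - \<theta> r (F (tr g \<otimes>\<^bsub>P\<^esub> r))\<bar> ^ p)"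
    by (simp add: disp_def Z_def)
  also have "\<dots> \<le> (\<Sum>r\<in>R. \<Sum>g\<in>Z r. \<bar>F (tr (h \<otimes> g) \<otimes>\<^bsub>P\<^esub> r) - F (tr g \<otimes>\<^bsub>P\<^esub> r)\<bar> ^ p)"
    by (intro sum_mono power_mono lip) auto
  also have "\<dots> = (\<Sum>(r, g)\<in>Sigma R Z. \<bar>F (tr (h \<otimes> g) \<otimes>\<^bsub>P\<^esub> r) - F (tr g \<otimes>\<^bsub>P\<^esub> r)\<bar> ^ p)"
    using R finZr by (intro sum.Sigma) auto
  also have "\<dots> = (\<Sum>z\<in>Sigma R Z. \<bar>F (tr h \<otimes>\<^bsub>P\<^esub> e z) - F (e z)\<bar> ^ p)"
    using R h by (intro sum.cong) (auto simp: e_def Z_def translation_mult_assoc subset_iff)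
  also have "\<dots> = (\<Sum>x\<in>e ` Sigma R Z. \<bar>F (tr h \<otimes>\<^bsub>P\<^esub> x) - F x\<bar> ^ p)"
    using inj by (simp add: sum.reindex)
  also have "\<dots> \<le> (\<Sum>x\<in>W. \<bar>F (tr h \<otimes>\<^bsub>P\<^esub> x) - F x\<bar> ^ p)"
    using W sub by (intro sum_mono2) auto
  finally show ?thesis by (simp add: disp_def W_def)
qed

text \<open>On the fibre over \<open>r\<close> the excess of \<open>\<bar>F x\<bar>\<close> over
  \<open>t r\<close>, read as a function of the drift, has at most \<open>n\<close> support points.
  The profile of \<open>G\<close> at \<open>n\<close> therefore bounds its mass by its energy, and
  the energies add up by \<open>sum_fibre_disp_le\<close>.\<close>

lemma truncated_mass_le:
  assumes \<phi>: "admissible_measure G \<phi>" and p: "p = 1 \<or> p = 2"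
    and F: "finite (supp_on P F)"
    and lam: "profile p G \<phi> (real n) = ennreal lam" "0 \<le> lam"
    and t: "\<And>r. card {x \<in> supp_on P F. perm_part x = r \<and> t r < \<bar>F x\<bar>} \<le> n" "\<And>r. 0 \<le> t r"
  shows "lam * (\<Sum>x\<in>supp_on P F. max 0 (\<bar>F x\<bar> - t (perm_part x)) ^ p)
    \<le> 1 / 2 * (\<Sum>h\<in>set_pmf \<phi>. pmf \<phi> h * disp P p F (tr h))"
proof -
  have p0: "p > 0" using p by auto
  have fin\<phi>: "finite (set_pmf \<phi>)" and sub\<phi>: "set_pmf \<phi> \<subseteq> carrier G"
    using \<phi> by (auto simp: admissible_measure_def symmetric_measure_def)
  define S where "S = supp_on P F"
  have SP: "S \<subseteq> carrier P" "finite S" using F by (auto simp: S_def supp_on_def)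
  define \<theta> where "\<theta> r a = max 0 (\<bar>a\<bar> - t r)" for r a
  define f where "f r g = \<theta> r (F (tr g \<otimes>\<^bsub>P\<^esub> r))" for r g
  define R where "R = perm_part ` S"
  have R: "finite R" "R \<subseteq> finitary" using SP perm_part_finitary by (auto simp: R_def)
  have \<theta>0: "0 \<le> \<theta> r a" for r a by (simp add: \<theta>_def)
  have fibre: "lam * (\<Sum>x | x \<in> S \<and> perm_part x = r. \<theta> r (F x) ^ p) \<le> energy G \<phi> p (f r)"
    if r: "r \<in> R" for r
  proof -
    have rc: "r \<in> finitary" "r \<in> carrier P" using R r by auto
    define A where "A = {x \<in> S. perm_part x = r \<and> t r < \<bar>F x\<bar>}"
    define Z where "Z = drift ` {x \<in> S. perm_part x = r}"
    have inj: "inj_on drift {x \<in> S. perm_part x = r}"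
    proof (rule inj_onI)
      fix x y assume "x \<in> {x \<in> S. perm_part x = r}" "y \<in> {x \<in> S. perm_part x = r}" "drift x = drift y"
      then show "x = y" using translation_perm_part SP by (metis (mono_tags, lifting) mem_Collect_eq subset_iff)
    qed
    have supp: "supp_on G (f r) \<subseteq> drift ` A"
    proof
      fix g assume "g \<in> supp_on G (f r)"
      then have g: "g \<in> carrier G" "t r < \<bar>F (tr g \<otimes>\<^bsub>P\<^esub> r)\<bar>"
        by (auto simp: supp_on_def f_def \<theta>_def max_def split: if_splits)
      have "tr g \<otimes>\<^bsub>P\<^esub> r \<in> carrier P" using g rc translation_in_carrier by simp
      moreover have "F (tr g \<otimes>\<^bsub>P\<^esub> r) \<noteq> 0" using g(2) t(2)[of r] by auto
      ultimately have "tr g \<otimes>\<^bsub>P\<^esub> r \<in> A"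
        using g(2) perm_part_translation_finitary[OF g(1) rc(1)] by (simp add: A_def S_def supp_on_def)
      then show "g \<in> drift ` A"
        by (rule image_eqI[rotated]) (rule drift_translation_finitary[OF g(1) rc(1), symmetric])
    qed
    have finA: "finite A" using SP by (simp add: A_def)
    then have fins: "finite (supp_on G (f r))" using supp finite_subset by blast
    have "card (supp_on G (f r)) \<le> card (drift ` A)" using finA supp by (intro card_mono) auto
    also have "\<dots> \<le> card A" using finA by (rule card_image_le)
    also have "\<dots> \<le> n" using t(1)[of r] by (simp add: A_def S_def)
    finally have "ennreal lam * ennreal (mass G p (f r)) \<le> ennreal (energy G \<phi> p (f r))"
      using profile_mult_mass_le[OF fin\<phi> sub\<phi> p0 fins, of "real n"] lam by simp
    then have le: "lam * mass G p (f r) \<le> energy G \<phi> p (f r)"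
      using lam(2) by (simp add: ennreal_mult''[symmetric] mass_nonneg energy_nonneg)
    have "mass G p (f r) = (\<Sum>g\<in>Z. \<bar>f r g\<bar> ^ p)"
    proof (rule mass_eq_sum[OF _ _ _ p0])
      show "supp_on G (f r) \<subseteq> Z" using supp by (auto simp: Z_def A_def)
    qed (use SP drift_closed in \<open>auto simp: Z_def\<close>)
    also have "\<dots> = (\<Sum>x | x \<in> S \<and> perm_part x = r. \<bar>f r (drift x)\<bar> ^ p)"
      unfolding Z_def using inj by (simp add: sum.reindex)
    also have "\<dots> = (\<Sum>x | x \<in> S \<and> perm_part x = r. \<theta> r (F x) ^ p)"
    proof (rule sum.cong[OF refl])
      fix x assume x: "x \<in> {x. x \<in> S \<and> perm_part x = r}"
      then have "tr (drift x) \<otimes>\<^bsub>P\<^esub> r = x" using SP translation_perm_part by auto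
      then show "\<bar>f r (drift x)\<bar> ^ p = \<theta> r (F x) ^ p" by (simp add: f_def \<theta>0)
    qed
    finally show ?thesis using le by simp
  qed
  have "lam * (\<Sum>x\<in>S. \<theta> (perm_part x) (F x) ^ p)
    = lam * (\<Sum>r\<in>R. \<Sum>x | x \<in> S \<and> perm_part x = r. \<theta> (perm_part x) (F x) ^ p)"
    unfolding R_def using SP by (subst sum.image_gen[of S _ perm_part]) auto
  also have "\<dots> = (\<Sum>r\<in>R. lam * (\<Sum>x | x \<in> S \<and> perm_part x = r. \<theta> r (F x) ^ p))"
    by (simp add: sum_distrib_left)
  also have "\<dots> \<le> (\<Sum>r\<in>R. energy G \<phi> p (f r))"
    using fibre by (rule sum_mono)
  also have "\<dots> = 1 / 2 * (\<Sum>h\<in>set_pmf \<phi>. pmf \<phi> h * (\<Sum>r\<in>R. disp G p (f r) h))"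
    unfolding energy_def sum_distrib_left by (rule sum.swap)
  also have "\<dots> \<le> 1 / 2 * (\<Sum>h\<in>set_pmf \<phi>. pmf \<phi> h * disp P p F (tr h))"
    using sub\<phi> unfolding f_def
    by (intro mult_left_mono sum_mono sum_fibre_disp_le[OF F R]) (auto simp: \<theta>_def)
  finally show ?thesis by (simp add: S_def \<theta>_def)
qed

text \<open>Each fibre is truncated at its own level with threshold \<open>3 * k\<close>. The
  level-set inequality bounds the mass by the dispersion of the transposition plus the excess
  \<open>K\<close>; after multiplication by \<open>lam\<close> the excess is bounded by translation
  energy.\<close>

lemma mass_le_dispersion:
  assumes \<phi>: "admissible_measure G \<phi>" and p: "p = 1 \<or> p = 2"
    and F: "finite (supp_on P F)" and k: "card (supp_on P F) < fact (k + 1)"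
    and lam: "profile p G \<phi> (real (3 * k)) = ennreal lam" "0 \<le> lam"
  shows "lam * mass P p F \<le> 432 * (lam * disp P p F \<tau>
    + 1 / 2 * (\<Sum>h\<in>set_pmf \<phi>. pmf \<phi> h * disp P p F (tr h)))"
proof -
  have p0: "p > 0" using p by auto
  define S where "S = supp_on P F"
  have SP: "S \<subseteq> carrier P" "finite S" using F by (auto simp: S_def supp_on_def)
  have "\<forall>r. \<exists>t. 0 \<le> t \<and> card {x \<in> S. perm_part x = r \<and> t < \<bar>F x\<bar>} \<le> 3 * k
      \<and> (t = 0 \<or> 3 * k < card {x \<in> S. perm_part x = r \<and> t \<le> \<bar>F x\<bar>})"
  proof
    fix r
    have "finite {x \<in> S. perm_part x = r}" using SP by simp
    from exists_truncation_level[OF this, of "\<lambda>x. \<bar>F x\<bar>" "3 * k"]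
    show "\<exists>t. 0 \<le> t \<and> card {x \<in> S. perm_part x = r \<and> t < \<bar>F x\<bar>} \<le> 3 * k
      \<and> (t = 0 \<or> 3 * k < card {x \<in> S. perm_part x = r \<and> t \<le> \<bar>F x\<bar>})"
      by (simp only: mem_Collect_eq conj_assoc)
  qed
  from choice[OF this] obtain t where t: "\<And>r. 0 \<le> t r"
    "\<And>r. card {x \<in> S. perm_part x = r \<and> t r < \<bar>F x\<bar>} \<le> 3 * k"
    "\<And>r. t r = 0 \<or> 3 * k < card {x \<in> S. perm_part x = r \<and> t r \<le> \<bar>F x\<bar>}"
    by blast
  define K where "K = (\<Sum>x\<in>S. max 0 (\<bar>F x\<bar> - t (perm_part x)) ^ p)"
  have "(\<Sum>x\<in>S. \<bar>F x\<bar> ^ p) \<le> 432 * ((\<Sum>x\<in>S. \<bar>\<bar>F (\<tau> \<otimes>\<^bsub>P\<^esub> x)\<bar> - \<bar>F x\<bar>\<bar> ^ p) + K)"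
    unfolding K_def
  proof (rule functional_from_level_sets_diff[OF SP(2) p, where n = "3 * k" and t = t and c = perm_part])
    show "\<tau> \<otimes>\<^bsub>P\<^esub> (\<tau> \<otimes>\<^bsub>P\<^esub> x) = x" if "x \<in> S" for x
      using that SP by (intro transposition_twice) auto
    show "\<bar>F (\<tau> \<otimes>\<^bsub>P\<^esub> x)\<bar> = 0" if "x \<in> S" "\<tau> \<otimes>\<^bsub>P\<^esub> x \<notin> S" for x
      using that SP transposition_in_carrier by (auto simp: S_def supp_on_def)
    \<comment> \<open>Subsets of the support inherit its size bound \<open>fact (k + 1)\<close>;
      this is where the volume restriction enters.\<close>
    show "card T \<le> 3 * card {x \<in> T. \<tau> \<otimes>\<^bsub>P\<^esub> x \<notin> T}
        + 6 * card {x \<in> T. card {y \<in> T. perm_part y = perm_part x} \<le> 3 * k}" if T: "T \<subseteq> S" for T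
    proof (rule level_set_inequality)
      have "card T \<le> card S" using T SP by (intro card_mono) auto
      then show "card T < fact (k + 1)" using k by (simp add: S_def)
    qed (use T SP finite_subset[OF T SP(2)] in auto)
  qed (use t in auto)
  also have "(\<Sum>x\<in>S. \<bar>F x\<bar> ^ p) = mass P p F" by (simp add: S_def mass_def)
  also have "(\<Sum>x\<in>S. \<bar>\<bar>F (\<tau> \<otimes>\<^bsub>P\<^esub> x)\<bar> - \<bar>F x\<bar>\<bar> ^ p) \<le> disp P p F \<tau>"
  proof -
    let ?W = "{x \<in> carrier P. F (\<tau> \<otimes>\<^bsub>P\<^esub> x) \<noteq> F x}"
    have W: "finite ?W" by (rule P.finite_disp_support[OF F transposition_in_carrier])
    have "(\<Sum>x\<in>S. \<bar>\<bar>F (\<tau> \<otimes>\<^bsub>P\<^esub> x)\<bar> - \<bar>F x\<bar>\<bar> ^ p) \<le> (\<Sum>x\<in>S. \<bar>F (\<tau> \<otimes>\<^bsub>P\<^esub> x) - F x\<bar> ^ p)"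
      by (intro sum_mono power_mono) auto
    also have "\<dots> \<le> (\<Sum>x\<in>S \<union> ?W. \<bar>F (\<tau> \<otimes>\<^bsub>P\<^esub> x) - F x\<bar> ^ p)"
      using SP W by (intro sum_mono2) auto
    also have "\<dots> = disp P p F \<tau>"
      using SP W p0 by (intro disp_eq_sum[symmetric]) auto
    finally show ?thesis .
  qed
  finally have "mass P p F \<le> 432 * (disp P p F \<tau> + K)" by simp
  then have "lam * mass P p F \<le> lam * (432 * (disp P p F \<tau> + K))"
    using lam(2) by (rule mult_left_mono)
  also have "\<dots> = 432 * (lam * disp P p F \<tau> + lam * K)" by (simp add: algebra_simps)
  also have "lam * K \<le> 1 / 2 * (\<Sum>h\<in>set_pmf \<phi>. pmf \<phi> h * disp P p F (tr h))"
    unfolding K_def S_def using t by (intro truncated_mass_le[OF \<phi> p F lam]) (auto simp: S_def)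
  finally show ?thesis by simp
qed

text \<open>The energy of \<open>\<psi>\<close> controls the dispersions of \<tau> and of the
  translations. The factor \<open>lam\<close> in front of the former is bounded by the energy of a
  point mass, so \<open>c\<close> depends neither on \<open>v\<close> nor on
  \<open>k\<close>.\<close>

lemma profile_pocket_ge:
  assumes \<phi>: "admissible_measure G \<phi>" and \<psi>: "admissible_measure P \<psi>" and p: "p = 1 \<or> p = 2"
  shows "\<exists>c>0. \<forall>v k. 1 \<le> k \<longrightarrow> v < fact (k + 1) \<longrightarrow>
    ennreal c * profile p G \<phi> (real (3 * k)) \<le> profile p P \<psi> v"
proof -
  have p0: "p > 0" using p by auto
  have fin\<phi>: "finite (set_pmf \<phi>)" and sub\<phi>: "set_pmf \<phi> \<subseteq> carrier G"
    and fin\<psi>: "finite (set_pmf \<psi>)" and sub\<psi>: "set_pmf \<psi> \<subseteq> carrier P"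
    using \<phi> \<psi> by (auto simp: admissible_measure_def symmetric_measure_def)
  obtain C where C: "C > 0" "\<And>F. finite (supp_on P F) \<Longrightarrow> disp P p F \<tau> \<le> C * energy P \<psi> p F"
    using P.disp_le_energy[OF \<psi> p transposition_in_carrier] by blast
  have "\<forall>h\<in>set_pmf \<phi>. \<exists>D>0. \<forall>F. finite (supp_on P F) \<longrightarrow> disp P p F (tr h) \<le> D * energy P \<psi> p F"
    using P.disp_le_energy[OF \<psi> p translation_in_carrier] sub\<phi> by blast
  then obtain D where D: "\<And>h. h \<in> set_pmf \<phi> \<Longrightarrow> 0 < D h"
    "\<And>h F. h \<in> set_pmf \<phi> \<Longrightarrow> finite (supp_on P F) \<Longrightarrow> disp P p F (tr h) \<le> D h * energy P \<psi> p F"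
    by metis
  define E where "E = 1 / 2 * (\<Sum>h\<in>set_pmf \<phi>. pmf \<phi> h * D h)"
  have E0: "0 \<le> E"
    unfolding E_def using D(1) by (intro mult_nonneg_nonneg sum_nonneg) (auto intro: less_imp_le)
  define \<delta> :: "'a \<Rightarrow> real" where "\<delta> x = (if x = \<one> then 1 else 0)" for x
  have \<delta>: "supp_on G \<delta> = {\<one>}" by (auto simp: supp_on_def \<delta>_def)
  define B where "B = energy G \<phi> p \<delta>"
  have B0: "0 \<le> B" by (simp add: B_def energy_nonneg)
  \<comment> \<open>The summand \<open>1\<close> keeps the denominator positive.\<close>
  define c where "c = 1 / (432 * (B * C + E) + 1)"
  have pos: "0 < 432 * (B * C + E) + 1" using B0 E0 C(1) by (intro add_nonneg_pos) auto
  have "ennreal c * profile p G \<phi> (real (3 * k)) \<le> profile p P \<psi> v"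
    if k: "1 \<le> k" and v: "v < fact (k + 1)" for v k
  proof (rule P.profile_greatest[OF fin\<psi> sub\<psi> p0])
    fix F assume F: "finite (supp_on P F)" "real (card (supp_on P F)) \<le> v" "mass P p F = 1"
    \<comment> \<open>The point mass has one support point and is admissible since
      \<open>1 \<le> 3 * k\<close>; in particular the profile is finite there.\<close>
    have "profile p G \<phi> (real (3 * k)) \<le> ennreal B"
      using profile_mult_mass_le[OF fin\<phi> sub\<phi> p0, of \<delta> "real (3 * k)"] k \<delta>
      by (simp add: B_def mass_def \<delta>_def)
    then obtain lam where lam: "profile p G \<phi> (real (3 * k)) = ennreal lam" "0 \<le> lam" "lam \<le> B"
      using B0 by (cases "profile p G \<phi> (real (3 * k))") (auto simp: top_unique)
    have "real (card (supp_on P F)) < real (fact (k + 1))"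
      using le_less_trans[OF F(2) v] by (simp only: of_nat_fact)
    then have card: "card (supp_on P F) < fact (k + 1)" by (simp only: of_nat_less_iff)
    have e0: "0 \<le> energy P \<psi> p F" by (rule energy_nonneg)
    have 1: "lam * disp P p F \<tau> \<le> B * (C * energy P \<psi> p F)"
      using C F lam B0 by (intro mult_mono) (auto simp: disp_nonneg)
    have "1 / 2 * (\<Sum>h\<in>set_pmf \<phi>. pmf \<phi> h * disp P p F (tr h))
      \<le> 1 / 2 * (\<Sum>h\<in>set_pmf \<phi>. pmf \<phi> h * (D h * energy P \<psi> p F))"
      using D(2) F by (intro mult_left_mono sum_mono) auto
    also have "\<dots> = E * energy P \<psi> p F"
      by (simp add: E_def sum_distrib_left mult_ac)
    finally have 2: "1 / 2 * (\<Sum>h\<in>set_pmf \<phi>. pmf \<phi> h * disp P p F (tr h)) \<le> E * energy P \<psi> p F" .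
    have "lam \<le> 432 * (lam * disp P p F \<tau>
        + 1 / 2 * (\<Sum>h\<in>set_pmf \<phi>. pmf \<phi> h * disp P p F (tr h)))"
      using mass_le_dispersion[OF \<phi> p F(1) card lam(1,2)] by (simp only: F(3) mult_1_right)
    also have "\<dots> \<le> 432 * (B * (C * energy P \<psi> p F) + E * energy P \<psi> p F)"
      by (intro mult_left_mono add_mono 1 2) simp
    also have "\<dots> = (432 * (B * C + E)) * energy P \<psi> p F" by (simp add: algebra_simps)
    also have "\<dots> \<le> (432 * (B * C + E) + 1) * energy P \<psi> p F"
      using e0 by (intro mult_right_mono) auto
    finally have "c * lam \<le> energy P \<psi> p F"
      using pos by (simp add: c_def field_simps)
    then show "ennreal c * profile p G \<phi> (real (3 * k)) \<le> ennreal (energy P \<psi> p F)"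
      using lam pos by (simp add: ennreal_mult'[symmetric] c_def ennreal_leI)
  qed
  then show ?thesis using pos by (intro exI[of _ c]) (auto simp: c_def)
qed

section \<open>Upper bound\<close>

text \<open>At drift \<open>g\<close> the transposition exchanges \<open>None\<close> with
  \<open>Some (inv g)\<close> in the permutation coordinate, hence the inverses.\<close>

definition window :: "('a \<Rightarrow> real) \<Rightarrow> 'a option set" where
  "window f = insert None ((\<lambda>g. Some (inv g)) ` supp_on G f)"

definition window_perms :: "('a \<Rightarrow> real) \<Rightarrow> ('a option \<Rightarrow> 'a option) set" where
  "window_perms f = {y \<in> finitary. \<forall>l\<in>X - window f. y l = l}"

definition pocket_test :: "('a \<Rightarrow> real) \<Rightarrow> ('a option \<Rightarrow> 'a option) \<Rightarrow> real" where
  "pocket_test f x = (if perm_part x \<in> window_perms f then f (drift x) else 0)"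

text \<open>A permutation that fixes every point outside the window maps the window onto itself and
  is determined by its restriction there.\<close>

lemma finite_window_perms:
  assumes "finite (supp_on G f)"
  shows "finite (window_perms f)" and "card (window_perms f) \<le> fact (card (supp_on G f) + 1)"
proof -
  let ?V = "window f"
  have V: "finite ?V" "?V \<subseteq> X"
    using assms by (auto simp: window_def pocket_points_def supp_on_def)
  have cardV: "card ?V \<le> card (supp_on G f) + 1"
    using card_image_le[OF assms, of "\<lambda>g. Some (inv g)"] assms
    by (simp add: window_def card_insert_if)
  \<comment> \<open>Elements of the pocket extension are extensional on \<open>X\<close>, while
    \<open>permutes\<close> requires the identity off the window on the whole type; \<open>e\<close>
    converts between the two.\<close>
  define e where "e y l = (if l \<in> ?V then y l else l)" for y :: "'a option \<Rightarrow> 'a option" and l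
  have "e y permutes ?V" if y: "y \<in> window_perms f" for y
  proof (rule bij_imp_permutes)
    have bij: "bij_betw y X X" using y bij_betw_of_carrier by (simp add: window_perms_def)
    have fix1: "y ` (X - ?V) = X - ?V" using y by (force simp: window_perms_def)
    have "y ` ?V = y ` (X - (X - ?V))" using V by (simp add: double_diff)
    also have "\<dots> = y ` X - y ` (X - ?V)"
      using bij by (intro inj_on_image_set_diff[of y X]) (auto simp: bij_betw_def)
    also have "\<dots> = ?V" using bij V fix1 by (auto simp: bij_betw_def)
    finally have "y ` ?V = ?V" .
    moreover have "inj_on y ?V" using bij V by (auto simp: bij_betw_def intro: inj_on_subset)
    ultimately have "bij_betw y ?V ?V" by (simp add: bij_betw_def)
    then show "bij_betw (e y) ?V ?V" by (rule iffD1[OF bij_betw_cong, rotated]) (simp add: e_def)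
  qed (simp add: e_def)
  then have sub: "e ` window_perms f \<subseteq> {q. q permutes ?V}" by blast
  have inj: "inj_on e (window_perms f)"
  proof (rule inj_onI)
    fix y z assume yz: "y \<in> window_perms f" "z \<in> window_perms f" "e y = e z"
    show "y = z"
    proof (rule pocket_ext)
      fix l assume "l \<in> X"
      then show "y l = z l"
        using yz(1,2) fun_cong[OF yz(3), of l] by (cases "l \<in> ?V") (simp_all add: window_perms_def e_def)
    qed (use yz in \<open>auto simp: window_perms_def\<close>)
  qed
  show "finite (window_perms f)"
    using inj sub finite_permutations[OF V(1)] by (meson finite_imageD finite_subset)
  have "card (window_perms f) = card (e ` window_perms f)" using inj by (simp add: card_image)
  also have "\<dots> \<le> card {q. q permutes ?V}"
    using sub finite_permutations[OF V(1)] by (intro card_mono)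
  also have "\<dots> = fact (card ?V)" using V(1) by (simp add: card_permutations)
  also have "\<dots> \<le> fact (card (supp_on G f) + 1)" using cardV by (rule fact_mono)
  finally show "card (window_perms f) \<le> fact (card (supp_on G f) + 1)" .
qed

text \<open>Makes the number of window permutations positive, so that it can be cancelled in
  \<open>profile_pocket_le\<close>.\<close>

lemma one_in_window_perms: "\<one>\<^bsub>P\<^esub> \<in> window_perms f"
proof -
  have "drift \<one>\<^bsub>P\<^esub> = \<one>"
    using drift_eqI[OF drifts_translation[of \<one>]] by (simp add: translation_one)
  moreover have "(\<one>\<^bsub>P\<^esub>) l = l" if "l \<in> X" for l
    using that by (auto simp: translation_one[symmetric] translation_apply pocket_points_def)
  ultimately show ?thesis by (simp add: window_perms_def)
qed

lemma translation_image_Times: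
  assumes "Q \<subseteq> finitary"
  shows "(\<lambda>(y, g). tr g \<otimes>\<^bsub>P\<^esub> y) ` (Q \<times> {g \<in> carrier G. B g})
    = {x \<in> carrier P. perm_part x \<in> Q \<and> B (drift x)}" (is "?e ` _ = _")
proof safe
  fix y g assume y: "y \<in> Q" and g: "g \<in> carrier G" "B g"
  have yf: "y \<in> finitary" using assms y by blast
  show "tr g \<otimes>\<^bsub>P\<^esub> y \<in> carrier P" using yf g by (simp add: translation_in_carrier)
  show "perm_part (tr g \<otimes>\<^bsub>P\<^esub> y) \<in> Q" using y perm_part_translation_finitary[OF g(1) yf] by simp
  show "B (drift (tr g \<otimes>\<^bsub>P\<^esub> y))" using g drift_translation_finitary[OF g(1) yf] by simp
next
  fix x assume x: "x \<in> carrier P" "perm_part x \<in> Q" "B (drift x)"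
  show "x \<in> ?e ` (Q \<times> {g \<in> carrier G. B g})"
    by (rule image_eqI[of _ _ "(perm_part x, drift x)"])
       (use x translation_perm_part[OF x(1)] drift_closed[OF x(1)] in auto)
qed

text \<open>In the coordinates permutation part and drift the index set is a product. Mass and
  translation dispersion of the test function are sums of this form, so they carry the same
  factor.\<close>

lemma sum_semidirect:
  assumes "Q \<subseteq> finitary"
  shows "(\<Sum>x | x \<in> carrier P \<and> perm_part x \<in> Q \<and> B (drift x). u (drift x) :: real)
    = real (card Q) * (\<Sum>g | g \<in> carrier G \<and> B g. u g)"
proof -
  let ?e = "\<lambda>(y, g). tr g \<otimes>\<^bsub>P\<^esub> y"
  let ?B = "{g \<in> carrier G. B g}"
  have inj: "inj_on ?e (Q \<times> ?B)"
    by (rule inj_on_subset[OF inj_on_semidirect]) (use assms in auto)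
  have "(\<Sum>x | x \<in> carrier P \<and> perm_part x \<in> Q \<and> B (drift x). u (drift x))
      = (\<Sum>z\<in>Q \<times> ?B. u (drift (?e z)))"
    unfolding translation_image_Times[OF assms, symmetric] using inj by (simp add: sum.reindex)
  also have "\<dots> = (\<Sum>z\<in>Q \<times> ?B. u (snd z))"
  proof (rule sum.cong[OF refl])
    fix z assume "z \<in> Q \<times> ?B"
    then show "u (drift (?e z)) = u (snd z)"
      using assms drift_translation_finitary[of "snd z" "fst z"] by (cases z) auto
  qed
  also have "\<dots> = (\<Sum>y\<in>Q. \<Sum>g\<in>?B. u g)"
    unfolding sum.cartesian_product by (intro sum.cong) auto
  also have "\<dots> = real (card Q) * (\<Sum>g\<in>?B. u g)" by simp
  finally show ?thesis .
qed

lemma window_perms_subset: "window_perms f \<subseteq> finitary"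
  by (auto simp: window_perms_def)

section \<open>Support, mass and dispersion of the test function\<close>

lemma supp_pocket_test:
  "supp_on P (pocket_test f)
    = {x \<in> carrier P. perm_part x \<in> window_perms f \<and> f (drift x) \<noteq> 0}"
  by (auto simp: supp_on_def pocket_test_def)

lemma
  assumes f: "finite (supp_on G f)"
  shows finite_supp_pocket_test: "finite (supp_on P (pocket_test f))"
    and card_supp_pocket_test:
      "card (supp_on P (pocket_test f)) = card (window_perms f) * card (supp_on G f)"
proof -
  have eq: "supp_on P (pocket_test f)
    = (\<lambda>(y, g). tr g \<otimes>\<^bsub>P\<^esub> y) ` (window_perms f \<times> supp_on G f)"
    unfolding supp_pocket_test supp_on_def[of G]
    by (rule translation_image_Times[OF window_perms_subset, symmetric])
  have "inj_on (\<lambda>(y, g). tr g \<otimes>\<^bsub>P\<^esub> y) (window_perms f \<times> supp_on G f)"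
    by (rule inj_on_subset[OF inj_on_semidirect]) (auto simp: window_perms_def supp_on_def)
  then show "card (supp_on P (pocket_test f)) = card (window_perms f) * card (supp_on G f)"
    unfolding eq by (simp add: card_image card_cartesian_product)
  show "finite (supp_on P (pocket_test f))"
    unfolding eq using f finite_window_perms(1)[OF f] by simp
qed

lemma mass_pocket_test: "mass P p (pocket_test f) = real (card (window_perms f)) * mass G p f"
proof -
  have "mass P p (pocket_test f)
    = (\<Sum>x | x \<in> carrier P \<and> perm_part x \<in> window_perms f \<and> f (drift x) \<noteq> 0. \<bar>f (drift x)\<bar> ^ p)"
    unfolding mass_def supp_pocket_test by (rule sum.cong) (auto simp: pocket_test_def)
  also have "\<dots> = real (card (window_perms f)) * mass G p f"
    unfolding mass_def supp_on_def by (rule sum_semidirect[OF window_perms_subset])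
  finally show ?thesis .
qed

lemma disp_pocket_test_translation:
  assumes h: "h \<in> carrier G"
  shows "disp P p (pocket_test f) (tr h) = real (card (window_perms f)) * disp G p f h"
proof -
  have val: "pocket_test f (tr h \<otimes>\<^bsub>P\<^esub> x) = (if perm_part x \<in> window_perms f then f (h \<otimes> drift x) else 0)"
    if "x \<in> carrier P" for x
    using that h by (simp add: pocket_test_def perm_part_translation_mult drift_translation_mult)
  have "disp P p (pocket_test f) (tr h)
    = (\<Sum>x | x \<in> carrier P \<and> perm_part x \<in> window_perms f \<and> f (h \<otimes> drift x) \<noteq> f (drift x).
        \<bar>f (h \<otimes> drift x) - f (drift x)\<bar> ^ p)"
    unfolding disp_def
  proof (rule sum.cong)
    have "pocket_test f (tr h \<otimes>\<^bsub>P\<^esub> x) \<noteq> pocket_test f x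
      \<longleftrightarrow> perm_part x \<in> window_perms f \<and> f (h \<otimes> drift x) \<noteq> f (drift x)" if "x \<in> carrier P" for x
      unfolding val[OF that] by (simp add: pocket_test_def)
    then show "{x \<in> carrier P. pocket_test f (tr h \<otimes>\<^bsub>P\<^esub> x) \<noteq> pocket_test f x}
      = {x. x \<in> carrier P \<and> perm_part x \<in> window_perms f \<and> f (h \<otimes> drift x) \<noteq> f (drift x)}"
      by blast
    fix x assume "x \<in> {x. x \<in> carrier P \<and> perm_part x \<in> window_perms f \<and> f (h \<otimes> drift x) \<noteq> f (drift x)}"
    then show "\<bar>pocket_test f (tr h \<otimes>\<^bsub>P\<^esub> x) - pocket_test f x\<bar> ^ p = \<bar>f (h \<otimes> drift x) - f (drift x)\<bar> ^ p"
      using val[of x] by (simp add: pocket_test_def[of f x])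
  qed
  also have "\<dots> = real (card (window_perms f)) * disp G p f h"
    unfolding disp_def by (rule sum_semidirect[OF window_perms_subset])
  finally show ?thesis .
qed

text \<open>The transposition only moves points of the window when the walker sits in the support
  of \<open>f\<close>, so it costs no energy at all.\<close>

lemma pocket_test_transposition:
  assumes x: "x \<in> carrier P"
  shows "pocket_test f (\<tau> \<otimes>\<^bsub>P\<^esub> x) = pocket_test f x"
proof (cases "drift x \<in> supp_on G f")
  case False
  then have "f (drift x) = 0" using drift_closed[OF x] by (simp add: supp_on_def)
  then show ?thesis using x by (simp add: pocket_test_def drift_transposition_mult)
next
  case True
  define u where "u = Some (inv (drift x))"
  have u: "u \<in> window f" "None \<in> window f" using True by (auto simp: u_def window_def)
  have tx: "\<tau> \<otimes>\<^bsub>P\<^esub> x \<in> carrier P" using x transposition_in_carrier by simp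
  have "perm_part (\<tau> \<otimes>\<^bsub>P\<^esub> x) l = l \<longleftrightarrow> perm_part x l = l" if l: "l \<in> X - window f" for l
  proof -
    have "l \<noteq> u" "l \<noteq> None" using u l by (metis DiffD2)+
    then show ?thesis
      using l by (auto simp: perm_part_transposition_mult[OF x] u_def[symmetric]
          Transposition.transpose_def)
  qed
  then have "perm_part (\<tau> \<otimes>\<^bsub>P\<^esub> x) \<in> window_perms f \<longleftrightarrow> perm_part x \<in> window_perms f"
    using perm_part_finitary[OF x] perm_part_finitary[OF tx] by (auto simp: window_perms_def)
  then show ?thesis using x by (simp add: pocket_test_def drift_transposition_mult)
qed

lemma disp_pocket_test_transposition: "disp P p (pocket_test f) \<tau> = 0"
  unfolding disp_def by (rule sum.neutral) (auto simp: pocket_test_transposition)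

text \<open>The mass and the translation dispersions of the test function are \<open>N f\<close>
  times those of \<open>f\<close>, and the transposition contributes nothing; the factor
  \<open>N f\<close> cancels against the mass.\<close>

lemma profile_pocket_le:
  assumes \<phi>: "admissible_measure G \<phi>" and \<psi>: "admissible_measure P \<psi>" and p: "p = 1 \<or> p = 2"
  shows "\<exists>c>0. \<forall>f v. finite (supp_on G f) \<longrightarrow> mass G p f = 1 \<longrightarrow>
    real (card (supp_on G f)) * fact (card (supp_on G f) + 1) \<le> v \<longrightarrow>
    profile p P \<psi> v \<le> ennreal c * ennreal (energy G \<phi> p f)"
proof -
  have p0: "p > 0" using p by auto
  have fin\<psi>: "finite (set_pmf \<psi>)" and sub\<psi>: "set_pmf \<psi> \<subseteq> carrier P"
    using \<psi> by (auto simp: admissible_measure_def symmetric_measure_def)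
  define N where "N f = real (card (window_perms f))" for f
  let ?I = "{f. finite (supp_on G f)}"
  have "\<exists>C>0. \<forall>f\<in>?I. disp P p (pocket_test f) y \<le> C * (N f * energy G \<phi> p f)"
    if y: "y \<in> carrier P" for y
  \<comment> \<open>All translations serve as generators. The constant may depend on
    \<open>y\<close>, because only the finitely many \<open>y\<close> in the support of
    \<open>\<psi>\<close> are used afterwards.\<close>
  proof (rule P.disp_generate_le[where S = "insert \<tau> (tr ` carrier G)", OF _ p])
    show "insert \<tau> (tr ` carrier G) \<subseteq> carrier P"
      using transposition_in_carrier translation_in_carrier by blast
    show "y \<in> generate P (insert \<tau> (tr ` carrier G))" using y by (simp add: generate_pocket_extension)
    fix s assume "s \<in> insert \<tau> (tr ` carrier G)"
    then consider "s = \<tau>" | h where "h \<in> carrier G" "s = tr h" by blast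
    then show "\<exists>C. \<forall>f\<in>?I. disp P p (pocket_test f) s \<le> C * (N f * energy G \<phi> p f)"
    proof cases
      case 1
      then show ?thesis by (intro exI[of _ 0]) (simp add: disp_pocket_test_transposition)
    next
      case 2
      obtain C where C: "\<And>f. finite (supp_on G f) \<Longrightarrow> disp G p f h \<le> C * energy G \<phi> p f"
        using disp_le_energy[OF \<phi> p 2(1)] by blast
      have "disp P p (pocket_test f) s \<le> C * (N f * energy G \<phi> p f)" if "f \<in> ?I" for f
      proof -
        have "N f * disp G p f h \<le> N f * (C * energy G \<phi> p f)"
          using that C by (intro mult_left_mono) (auto simp: N_def)
        then show ?thesis using 2 by (simp add: disp_pocket_test_translation N_def mult_ac)
      qed
      then show ?thesis by blast
    qed
  qed (auto simp: finite_supp_pocket_test N_def energy_nonneg)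
  then have "\<forall>y\<in>set_pmf \<psi>. \<exists>C>0. \<forall>f\<in>?I. disp P p (pocket_test f) y \<le> C * (N f * energy G \<phi> p f)"
    using sub\<psi> by blast
  then obtain C where C: "\<And>y. y \<in> set_pmf \<psi> \<Longrightarrow> 0 < C y"
    "\<And>y f. y \<in> set_pmf \<psi> \<Longrightarrow> f \<in> ?I \<Longrightarrow> disp P p (pocket_test f) y \<le> C y * (N f * energy G \<phi> p f)"
    by metis
  define c where "c = 1 / 2 * (\<Sum>y\<in>set_pmf \<psi>. pmf \<psi> y * C y)"
  have "0 < (\<Sum>y\<in>set_pmf \<psi>. pmf \<psi> y * C y)"
    using C(1) fin\<psi> by (intro sum_pos) (auto simp: pmf_positive set_pmf_not_empty)
  then have c: "0 < c" by (simp add: c_def)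
  have "profile p P \<psi> v \<le> ennreal c * ennreal (energy G \<phi> p f)"
    if f: "finite (supp_on G f)" "mass G p f = 1"
      and v: "real (card (supp_on G f)) * fact (card (supp_on G f) + 1) \<le> v" for f v
  proof -
    let ?F = "pocket_test f"
    have N: "0 < N f"
      using one_in_window_perms finite_window_perms(1)[OF f(1)] by (auto simp: N_def card_gt_0_iff)
    have "real (card (supp_on P ?F)) = N f * real (card (supp_on G f))"
      using f by (simp add: card_supp_pocket_test N_def)
    also have "\<dots> \<le> real (fact (card (supp_on G f) + 1)) * real (card (supp_on G f))"
      unfolding N_def using finite_window_perms(2)[OF f(1)]
      by (intro mult_right_mono) (simp_all only: of_nat_le_iff of_nat_0_le_iff)
    also have "\<dots> \<le> v" using v by (simp only: of_nat_fact mult.commute)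
    finally have card: "real (card (supp_on P ?F)) \<le> v" .
    have "energy P \<psi> p ?F \<le> 1 / 2 * (\<Sum>y\<in>set_pmf \<psi>. pmf \<psi> y * (C y * (N f * energy G \<phi> p f)))"
      unfolding energy_def[of P] using C(2) f by (intro mult_left_mono sum_mono) auto
    also have "\<dots> = N f * (c * energy G \<phi> p f)"
      by (simp add: c_def sum_distrib_left mult_ac)
    finally have le: "energy P \<psi> p ?F \<le> N f * (c * energy G \<phi> p f)" .
    have "ennreal (N f) * profile p P \<psi> v \<le> ennreal (energy P \<psi> p ?F)"
      using P.profile_mult_mass_le[OF fin\<psi> sub\<psi> p0 finite_supp_pocket_test[OF f(1)] card] f(2)
      by (simp add: mass_pocket_test N_def mult.commute)
    also have "\<dots> \<le> ennreal (N f) * ennreal (c * energy G \<phi> p f)"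
      using le N by (simp add: ennreal_mult'[symmetric] ennreal_leI)
    finally have "profile p P \<psi> v \<le> ennreal (c * energy G \<phi> p f)"
      using N by (subst (asm) ennreal_mult_le_mult_iff) auto
    then show ?thesis using c by (simp add: ennreal_mult')
  qed
  then show ?thesis using c by blast
qed

end

section \<open>The two bounds at arguments proportional to the volume ratio\<close>

theorem theorem4p9:
  fixes G :: "('a, 'b) monoid_scheme"
    and \<phi> :: "'a pmf"
    and \<psi> :: "('a option \<Rightarrow> 'a option) pmf"
    and p :: nat
  assumes "group G"
    and "infinite (carrier G)"
    and "finitely_generated G"
    and "admissible_measure G \<phi>"
    and "admissible_measure (pocket_extension G) \<psi>"
    and "p = 1 \<or> p = 2"
  shows "\<exists>c1 c2 c3 c4 :: real. c1 > 0 \<and> c2 > 0 \<and> c3 > 0 \<and> c4 > 0 \<and>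
    (\<forall>v::real. v > 0 \<longrightarrow>
       ennreal c1 * profile p G \<phi> (c2 * (ln (1 + v) / ln (1 + ln (1 + v))))
         \<le> profile p (pocket_extension G) \<psi> v \<and>
       profile p (pocket_extension G) \<psi> v
         \<le> ennreal c3 * profile p G \<phi> (c4 * (ln (1 + v) / ln (1 + ln (1 + v)))))"
proof -
  interpret infinite_group G
    using assms by (simp add: infinite_group_def infinite_group_axioms_def)
  have p0: "p > 0" using assms(6) by auto
  have fin\<phi>: "finite (set_pmf \<phi>)" and sub\<phi>: "set_pmf \<phi> \<subseteq> carrier G"
    and fin\<psi>: "finite (set_pmf \<psi>)" and sub\<psi>: "set_pmf \<psi> \<subseteq> carrier P"
    using assms(4,5) by (auto simp: admissible_measure_def symmetric_measure_def)
  obtain c1 where c1: "c1 > 0" "\<And>v k. 1 \<le> k \<Longrightarrow> v < fact (k + 1) \<Longrightarrow>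
    ennreal c1 * profile p G \<phi> (real (3 * k)) \<le> profile p P \<psi> v"
    using profile_pocket_ge[OF assms(4-6)] by blast
  obtain c3 where c3: "c3 > 0" "\<And>f v. finite (supp_on G f) \<Longrightarrow> mass G p f = 1 \<Longrightarrow>
    real (card (supp_on G f)) * fact (card (supp_on G f) + 1) \<le> v \<Longrightarrow>
    profile p P \<psi> v \<le> ennreal c3 * ennreal (energy G \<phi> p f)"
    using profile_pocket_le[OF assms(4-6)] by blast
  define r where "r v = ln (1 + v) / ln (1 + ln (1 + v))" for v :: real
  have lower: "ennreal c1 * profile p G \<phi> (30 * r v) \<le> profile p P \<psi> v" for v
  proof (cases "1 \<le> v")
    case True
    obtain k :: nat where k: "1 \<le> k" "v < fact (k + 1)" "real (3 * k) \<le> 30 * r v"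
      using exists_fact_gt[OF True] unfolding r_def by blast
    have "ennreal c1 * profile p G \<phi> (30 * r v) \<le> ennreal c1 * profile p G \<phi> (real (3 * k))"
      by (intro mult_left_mono profile_antimono k) simp
    also have "\<dots> \<le> profile p P \<psi> v" by (rule c1(2)[OF k(1,2)])
    finally show ?thesis .
  next
    \<comment> \<open>For \<open>v < 1\<close> the size bound leaves only functions vanishing on the
      group, whose mass is \<open>0\<close>; the infimum is over the empty set.\<close>
    case False
    show ?thesis
    proof (rule P.profile_greatest[OF fin\<psi> sub\<psi> p0])
      fix F assume F: "finite (supp_on P F)" "real (card (supp_on P F)) \<le> v" "mass P p F = 1"
      then have "card (supp_on P F) = 0" using False by linarith
      then have "supp_on P F = {}" using F(1) by simp
      then show "ennreal c1 * profile p G \<phi> (30 * r v) \<le> ennreal (energy P \<psi> p F)"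
        using F(3) by (simp add: mass_def)
    qed
  qed
  have upper: "profile p P \<psi> v \<le> ennreal c3 * profile p G \<phi> (1 / 4 * r v)" if v: "0 < v" for v
  proof -
    \<comment> \<open>Dividing by \<open>c3\<close> gives a claim about a lower bound of an infimum,
      checked on each admissible \<open>f\<close>. For \<open>1 / 4 * r v < 1\<close> there is none
      and the right side is infinite.\<close>
    have "profile p P \<psi> v / ennreal c3 \<le> profile p G \<phi> (1 / 4 * r v)"
    proof (rule profile_greatest[OF fin\<phi> sub\<phi> p0])
      fix f assume f: "finite (supp_on G f)" "real (card (supp_on G f)) \<le> 1 / 4 * r v" "mass G p f = 1"
      \<comment> \<open>Mass \<open>1\<close> forces a nonempty support, which
        \<open>fact_le_of_le_volume_ratio\<close> needs as \<open>1 \<le> n\<close>.\<close>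
      have "1 \<le> card (supp_on G f)"
        using f by (cases "card (supp_on G f)") (auto simp: mass_def)
      then have "real (card (supp_on G f)) * fact (card (supp_on G f) + 1) \<le> v"
        using fact_le_of_le_volume_ratio[OF v] f(2) by (simp add: r_def)
      then have "profile p P \<psi> v \<le> ennreal c3 * ennreal (energy G \<phi> p f)" by (rule c3(2)[OF f(1,3)])
      then show "profile p P \<psi> v / ennreal c3 \<le> ennreal (energy G \<phi> p f)"
        using c3(1) by (intro divide_le_posI_ennreal) auto
    qed
    then have "ennreal c3 * (profile p P \<psi> v / ennreal c3) \<le> ennreal c3 * profile p G \<phi> (1 / 4 * r v)"
      by (rule mult_left_mono) simp
    moreover have "ennreal c3 * (profile p P \<psi> v / ennreal c3) = profile p P \<psi> v"
      unfolding ennreal_times_divide mult.commute[of "ennreal c3"]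
      using c3(1) by (intro ennreal_mult_divide_eq) auto
    ultimately show ?thesis by simp
  qed
  show ?thesis
    using c1(1) c3(1) lower upper unfolding r_def
    by (intro exI[of _ c1] exI[of _ 30] exI[of _ c3] exI[of _ "1 / 4"]) auto
qed

end
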